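(* Let $S\in\mathcal{SA}_d(\mathbb{C}^n)$ be an $n\times n$ matrix-valued Schur--Agler function. Then, for every $k=1,\ldots,n$, the $k$-th permanental compound matrix-valued function of $S$ is also Schur--Agler. In particular, the permanent $\operatorname{per}S(z)$ of a Schur--Agler function $S$ is also Schur--Agler.
   Context: For Hilbert spaces $\mathcal{U},\mathcal{Y}$, the Schur--Agler class $\mathcal{SA}_d(\mathcal{U},\mathcal{Y})$ consists of analytic $\mathcal{L}(\mathcal{U},\mathcal{Y})$-valued functions $f(z)=\sum_{k\in\mathbb{N}_0^d}f_kz^k$ on $\mathbb{D}^d=\{z\in\mathbb{C}^d:|z_i|<1,\ i=1,\dots,d\}$ such that $\sup_T\|f(T)\|\le1$, where the supremum is over all $d$-tuples $T=(T_1,\ldots,T_d)$ of commuting strict contractions on a common Hilbert space and $f(T)=\sum_kf_k\otimes T^k$, with $T^k=T_1^{k_1}\cdots T_d^{k_d}$. $\mathcal{SA}_d(\mathcal{U})=\mathcal{SA}_d(\mathcal{U},\mathcal{U})$ and $\mathcal{SA}_d=\mathcal{SA}_d(\mathbb{C})$. The $k$-th permanental compound matrix of an $n\times n$ matrix $A$ is the $\binom nk\times\binom nk$ matrix, with rows and columns indexed by sequences $1\le i_1<\cdots<i_k\le n$, whose entry in position $((i_1,\ldots,i_k),(j_1,\ldots,j_k))$ is the permanent of the $k\times k$ submatrix of $A$ with rows $i_1,\ldots,i_k$ and columns $j_1,\ldots,j_k$; the permanental compound function of $S$ is obtained by applying this to $S(z)$ for each $z$. *)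

theory Defs
  imports "HOL-Analysis.Analysis" "HOL-Combinatorics.Permutations"
begin

section \<open>Complex Hilbert spaces\<close>

text \<open>
  A Hilbert space is a linear subspace \<open>H\<close> of a complex vector space with underlying type \<open>'h\<close>,
  together with an inner product \<open>ip\<close> (linear in the first argument) for which \<open>H\<close> is complete.
  Nothing is required of \<open>ip\<close> outside \<open>H\<close>.
\<close>

locale chilbert_space = vector_space scale
  for scale :: "complex \<Rightarrow> 'h::ab_group_add \<Rightarrow> 'h" +
  fixes H :: "'h set" and ip :: "'h \<Rightarrow> 'h \<Rightarrow> complex"
  assumes subspace_H: "subspace H"
    and ip_add: "\<lbrakk>x \<in> H; y \<in> H; z \<in> H\<rbrakk> \<Longrightarrow> ip (x + y) z = ip x z + ip y z"
    and ip_scale: "\<lbrakk>x \<in> H; y \<in> H\<rbrakk> \<Longrightarrow> ip (scale c x) y = c * ip x y"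
    and ip_cnj: "\<lbrakk>x \<in> H; y \<in> H\<rbrakk> \<Longrightarrow> ip y x = cnj (ip x y)"
    and ip_pos: "\<lbrakk>x \<in> H; x \<noteq> 0\<rbrakk> \<Longrightarrow> Re (ip x x) > 0"
    and complete_H:
      "\<lbrakk>\<And>m. X m \<in> H;
        \<And>e::real. e > 0 \<Longrightarrow>
          \<exists>N::nat. \<forall>m\<ge>N. \<forall>n\<ge>N. sqrt (Re (ip (X m - X n) (X m - X n))) < e\<rbrakk>
       \<Longrightarrow> \<exists>x\<in>H. (\<lambda>m. sqrt (Re (ip (X m - x) (X m - x)))) \<longlonglongrightarrow> 0"
begin

definition hnorm :: "'h \<Rightarrow> real" where
  "hnorm x = sqrt (Re (ip x x))"

definition strict_contraction :: "('h \<Rightarrow> 'h) \<Rightarrow> bool" where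
  "strict_contraction A \<longleftrightarrow>
     (\<forall>x\<in>H. A x \<in> H) \<and>
     (\<forall>x\<in>H. \<forall>y\<in>H. A (x + y) = A x + A y) \<and>
     (\<forall>c. \<forall>x\<in>H. A (scale c x) = scale c (A x)) \<and>
     (\<exists>r<1. \<forall>x\<in>H. hnorm (A x) \<le> r * hnorm x)"

definition commuting_strict_contractions :: "nat \<Rightarrow> (nat \<Rightarrow> 'h \<Rightarrow> 'h) \<Rightarrow> bool" where
  "commuting_strict_contractions d T \<longleftrightarrow>
     (\<forall>l<d. strict_contraction (T l)) \<and>
     (\<forall>l<d. \<forall>m<d. \<forall>x\<in>H. T l (T m x) = T m (T l x))"

end


section \<open>The Schur--Agler class for finite-dimensional coefficient spaces\<close>

text \<open>Coordinates, matrix rows and matrix columns are numbered from \<open>0\<close>.\<close>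

definition polydisc :: "nat \<Rightarrow> (nat \<Rightarrow> complex) set" where
  "polydisc d = (\<Pi>\<^sub>E l\<in>{..<d}. ball 0 1)"

definition multi_indices :: "nat \<Rightarrow> (nat \<Rightarrow> nat) set" where
  "multi_indices d = (\<Pi>\<^sub>E l\<in>{..<d}. UNIV)"

text \<open>
  Functions with values in \<open>\<L>(\<complex>\<^sup>J, \<complex>\<^sup>I)\<close>, for finite index sets \<open>J\<close> and \<open>I\<close>, are given by their
  matrix entries \<open>f z i j\<close> with \<open>i \<in> I\<close> and \<open>j \<in> J\<close>; other entries are irrelevant.
\<close>

definition has_power_series ::
  "nat \<Rightarrow> 'j set \<Rightarrow> 'i set \<Rightarrow> ((nat \<Rightarrow> complex) \<Rightarrow> 'i \<Rightarrow> 'j \<Rightarrow> complex)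
     \<Rightarrow> ((nat \<Rightarrow> nat) \<Rightarrow> 'i \<Rightarrow> 'j \<Rightarrow> complex) \<Rightarrow> bool" where
  "has_power_series d J I f c \<longleftrightarrow>
     (\<forall>z\<in>polydisc d. \<forall>i\<in>I. \<forall>j\<in>J.
        ((\<lambda>k. c k i j * (\<Prod>l<d. z l ^ k l)) has_sum f z i j) (multi_indices d))"

text \<open>\<open>T\<^sup>k = T\<^sub>0\<^bsup>k 0\<^esup> \<circ> T\<^sub>1\<^bsup>k 1\<^esup> \<circ> \<dots> \<circ> T\<^bsub>d-1\<^esub>\<^bsup>k (d-1)\<^esup>\<close>\<close>

definition monomial_op :: "nat \<Rightarrow> (nat \<Rightarrow> 'h \<Rightarrow> 'h) \<Rightarrow> (nat \<Rightarrow> nat) \<Rightarrow> 'h \<Rightarrow> 'h" where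
  "monomial_op d T k = foldr (\<lambda>l A. (T l ^^ k l) \<circ> A) [0..<d] id"

context chilbert_space
begin

text \<open>
  \<open>\<complex>\<^sup>J \<otimes> H\<close> is identified with \<open>H\<^sup>J\<close>, a vector being a family \<open>h\<close> with \<open>h j \<in> H\<close> for \<open>j \<in> J\<close>.
  For a matrix \<open>M\<close>, the operator \<open>M \<otimes> A\<close> then sends \<open>h\<close> to the family \<open>\<Sum>\<^sub>j M i j \<cdot> A (h j)\<close>.
\<close>

definition family_space :: "'j set \<Rightarrow> ('j \<Rightarrow> 'h) set" where
  "family_space J = {h. \<forall>j\<in>J. h j \<in> H}"

definition family_norm :: "'j set \<Rightarrow> ('j \<Rightarrow> 'h) \<Rightarrow> real" where
  "family_norm J h = sqrt (\<Sum>j\<in>J. (hnorm (h j))\<^sup>2)"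

definition matrix_tensor ::
  "'j set \<Rightarrow> ('i \<Rightarrow> 'j \<Rightarrow> complex) \<Rightarrow> ('h \<Rightarrow> 'h) \<Rightarrow> ('j \<Rightarrow> 'h) \<Rightarrow> 'i \<Rightarrow> 'h" where
  "matrix_tensor J M A h i = (\<Sum>j\<in>J. scale (M i j) (A (h j)))"

text \<open>
  \<open>F\<close> is the operator \<open>f(T) = \<Sum>\<^sub>k f\<^sub>k \<otimes> T\<^sup>k\<close>: the finite partial sums of the series, whose
  coefficients are \<open>c\<close>, converge (unconditionally) to \<open>F\<close> in operator norm.
\<close>

definition has_operator_value ::
  "nat \<Rightarrow> 'j set \<Rightarrow> 'i set \<Rightarrow> ((nat \<Rightarrow> nat) \<Rightarrow> 'i \<Rightarrow> 'j \<Rightarrow> complex) \<Rightarrow> (nat \<Rightarrow> 'h \<Rightarrow> 'h)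
     \<Rightarrow> (('j \<Rightarrow> 'h) \<Rightarrow> 'i \<Rightarrow> 'h) \<Rightarrow> bool" where
  "has_operator_value d J I c T F \<longleftrightarrow>
     (\<forall>h\<in>family_space J. F h \<in> family_space I) \<and>
     (\<forall>e>0. \<forall>\<^sub>F K in finite_subsets_at_top (multi_indices d).
        \<forall>h\<in>family_space J.
          family_norm I (\<lambda>i. F h i - (\<Sum>k\<in>K. matrix_tensor J (c k) (monomial_op d T k) h i))
            \<le> e * family_norm J h)"

end

text \<open>
  \<open>schur_agler TYPE('h) d J I\<close> is the class \<open>\<S>\<A>\<^sub>d(\<complex>\<^sup>J, \<complex>\<^sup>I)\<close>. A formula of HOL cannot quantify
  over types, so the supremum is over all Hilbert spaces whose additive group is a subgroup of the
  type \<open>'h\<close>, and statements about the class are to be made for arbitrary \<open>'h\<close>. A single \<open>'h\<close>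
  with room for the separable Hilbert spaces, such as \<open>complex fps\<close>, already yields the full class:
  \<open>\<parallel>f(T) h\<parallel>\<close> does not change when \<open>T\<close> is restricted to the separable closed subspace spanned by
  all \<open>T\<^sup>k (h j)\<close>. The bound \<open>\<parallel>f(T)\<parallel> \<le> 1\<close> is written out as \<open>\<parallel>f(T) h\<parallel> \<le> \<parallel>h\<parallel>\<close> for all \<open>h\<close>.
\<close>

definition schur_agler ::
  "'h::ab_group_add itself \<Rightarrow> nat \<Rightarrow> 'j set \<Rightarrow> 'i set
     \<Rightarrow> ((nat \<Rightarrow> complex) \<Rightarrow> 'i \<Rightarrow> 'j \<Rightarrow> complex) set" where
  "schur_agler _ d J I =
     {f. \<exists>c. has_power_series d J I f c \<and>
        (\<forall>(scale :: complex \<Rightarrow> 'h \<Rightarrow> 'h) H ip T.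
           chilbert_space scale H ip \<longrightarrow>
           chilbert_space.commuting_strict_contractions scale H ip d T \<longrightarrow>
           (\<exists>F. chilbert_space.has_operator_value scale H ip d J I c T F \<and>
              (\<forall>h \<in> chilbert_space.family_space H J.
                 chilbert_space.family_norm ip I (F h) \<le> chilbert_space.family_norm ip J h)))}"

text \<open>Scalar functions are treated as \<open>1 \<times> 1\<close> matrix functions.\<close>

definition scalar_schur_agler ::
  "'h::ab_group_add itself \<Rightarrow> nat \<Rightarrow> ((nat \<Rightarrow> complex) \<Rightarrow> complex) set" where
  "scalar_schur_agler h d = {f. (\<lambda>z _ _. f z) \<in> schur_agler h d {()} {()}}"


section \<open>Permanental compounds\<close>

definition permanent :: "nat \<Rightarrow> (nat \<Rightarrow> nat \<Rightarrow> complex) \<Rightarrow> complex" where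
  "permanent n A = (\<Sum>p | p permutes {..<n}. \<Prod>i<n. A i (p i))"

definition increasing_seqs :: "nat \<Rightarrow> nat \<Rightarrow> nat list set" where
  "increasing_seqs n k = {is. length is = k \<and> sorted_wrt (<) is \<and> set is \<subseteq> {..<n}}"

definition permanental_compound ::
  "nat \<Rightarrow> (nat \<Rightarrow> nat \<Rightarrow> complex) \<Rightarrow> nat list \<Rightarrow> nat list \<Rightarrow> complex" where
  "permanental_compound k A is js = permanent k (\<lambda>a b. A (is ! a) (js ! b))"

end

theory Submission
  imports Defs
begin

text \<open>
  The entries of \<open>S(T)\<close> commute, and \<open>S(T)\<close> acting on one factor of \<open>\<complex>\<^sup>n \<otimes> \<dots> \<otimes> \<complex>\<^sup>n \<otimes> H\<close> at a time is
  a contraction; the product over the \<open>k\<close> factors is the value at \<open>T\<close> of the \<open>k\<close>-fold Kronecker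
  power of \<open>S\<close>, which is therefore Schur--Agler. For \<open>i\<^sub>1 < \<dots> < i\<^sub>k\<close> the vectors
  \<open>(k!)\<^sup>-\<^sup>1\<^sup>/\<^sup>2 \<Sum>\<^sub>\<sigma> e\<^bsub>i \<sigma>(1)\<^esub> \<otimes> \<dots> \<otimes> e\<^bsub>i \<sigma>(k)\<^esub>\<close> are orthonormal, and compressing the Kronecker power
  to their span gives the \<open>k\<close>-th permanental compound.
\<close>

section \<open>Norms of families of vectors\<close>

text \<open>The analytic obstacle is convergence. The series of a Kronecker product is regrouped by
  the sum of the exponents, so its partial sums run over unions of antidiagonals of exponent pairs,
  while products of partial sums run over rectangles. Contractivity of \<open>S(T)\<close> says
  nothing about the pairs that separate the two. They are controlled by strictness: with a common
  ratio \<open>r < 1\<close>, the norm of \<open>T^k\<close> is at most \<open>r\<close> to the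
  total degree of \<open>k\<close>, and each entry of the power series converges absolutely at the
  point \<open>(r, ..., r)\<close> of the polydisc. Hence the terms are dominated by a summable
  product of weights. For the compression, the two factors \<open>1/sqrt(k!)\<close> are merged into
  a single \<open>1/k!\<close> on the coefficients. What results is a double sum over permutations
  of rows and of columns. It depends only on the relative permutation, so it consists of
  \<open>k!\<close> copies of the permanent, and the factor \<open>1/k!\<close> cancels.\<close>

context chilbert_space
begin

lemma zero_in_H [simp]: "0 \<in> H"
  using subspace_0[OF subspace_H] .

lemma add_in_H: "x \<in> H \<Longrightarrow> y \<in> H \<Longrightarrow> x + y \<in> H"
  using subspace_add[OF subspace_H] .

lemma diff_in_H: "x \<in> H \<Longrightarrow> y \<in> H \<Longrightarrow> x - y \<in> H"
  using subspace_diff[OF subspace_H] .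

lemma scale_in_H: "x \<in> H \<Longrightarrow> scale c x \<in> H"
  using subspace_scale[OF subspace_H] .

lemma sum_in_H: "(\<And>a. a \<in> A \<Longrightarrow> f a \<in> H) \<Longrightarrow> sum f A \<in> H"
  using subspace_sum[OF subspace_H] .

lemma hnorm_zero [simp]: "hnorm 0 = 0"
  using ip_scale[of 0 0 0] by (simp add: hnorm_def)

lemma ip_self_nonneg: "x \<in> H \<Longrightarrow> Re (ip x x) \<ge> 0"
  using ip_pos[of x] ip_scale[of 0 0 0] by (cases "x = 0") auto

lemma hnorm_nonneg [simp]: "x \<in> H \<Longrightarrow> hnorm x \<ge> 0"
  by (simp add: hnorm_def ip_self_nonneg)

lemma hnorm_power2: "x \<in> H \<Longrightarrow> (hnorm x)\<^sup>2 = Re (ip x x)"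
  by (simp add: hnorm_def ip_self_nonneg)

lemma ip_add_right:
  assumes "x \<in> H" "y \<in> H" "z \<in> H"
  shows "ip x (y + z) = ip x y + ip x z"
  using ip_cnj[OF _ assms(1)] ip_add[OF assms(2,3,1)] assms by (metis add_in_H complex_cnj_add)

lemma ip_scale_right:
  assumes "x \<in> H" "y \<in> H"
  shows "ip x (scale c y) = cnj c * ip x y"
  using ip_cnj[OF _ assms(1)] ip_scale[OF assms(2,1)] assms by (metis scale_in_H complex_cnj_mult)

lemma hnorm_scale: "x \<in> H \<Longrightarrow> hnorm (scale c x) = cmod c * hnorm x"
proof -
  assume x: "x \<in> H"
  have "ip (scale c x) (scale c x) = of_real ((cmod c)\<^sup>2) * ip x x"
    using x by (simp add: ip_scale ip_scale_right scale_in_H complex_norm_square del: of_real_power)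
  then show ?thesis
    by (simp add: hnorm_def real_sqrt_mult del: of_real_power)
qed

lemma hnorm_power2_add:
  assumes "x \<in> H" "y \<in> H"
  shows "(hnorm (x + y))\<^sup>2 = (hnorm x)\<^sup>2 + (hnorm y)\<^sup>2 + 2 * Re (ip x y)"
  using assms ip_cnj[OF assms]
  by (simp add: hnorm_power2 ip_add ip_add_right add_in_H)

text \<open>Cauchy-Schwarz for the real part, which is the part that the triangle inequality uses.
  With \<open>a\<close> and \<open>b\<close> the norms of \<open>x\<close> and \<open>y\<close>, the
  squared norm of \<open>b x - a y\<close> equals \<open>2ab(ab - Re (ip x y))\<close>, and it is
  nonnegative.\<close>

lemma Re_ip_le:
  assumes "x \<in> H" "y \<in> H"
  shows "Re (ip x y) \<le> hnorm x * hnorm y"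
proof (cases "x = 0 \<or> y = 0")
  case True
  then show ?thesis
    using assms ip_scale[of 0 y 0] ip_scale_right[of x 0 0] by auto
next
  case False
  define a b where "a = hnorm x" and "b = hnorm y"
  have ab: "a > 0" "b > 0"
    using False assms ip_pos by (auto simp: a_def b_def hnorm_def)
  have "0 \<le> (hnorm (scale (of_real b) x + scale (- of_real a) y))\<^sup>2"
    by simp
  also have "\<dots> = 2 * (a * b) * (a * b - Re (ip x y))"
    using assms ab
    by (simp add: hnorm_power2_add scale_in_H hnorm_scale ip_scale ip_scale_right power_mult_distrib
        del: complex_cnj_minus scale_minus_left)
       (simp add: a_def [symmetric] b_def [symmetric] power2_eq_square algebra_simps)
  finally show ?thesis
    using ab mult_pos_pos[OF ab] by (auto simp: zero_le_mult_iff a_def [symmetric] b_def [symmetric])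
qed

lemma hnorm_triangle:
  assumes "x \<in> H" "y \<in> H"
  shows "hnorm (x + y) \<le> hnorm x + hnorm y"
proof (rule power2_le_imp_le)
  show "(hnorm (x + y))\<^sup>2 \<le> (hnorm x + hnorm y)\<^sup>2"
    using assms Re_ip_le[OF assms] by (simp add: hnorm_power2_add power2_sum)
qed (use assms in simp)

lemma hnorm_sum_le:
  assumes "\<And>a. a \<in> A \<Longrightarrow> f a \<in> H"
  shows "hnorm (sum f A) \<le> (\<Sum>a\<in>A. hnorm (f a))"
  using assms
proof (induction A rule: infinite_finite_induct)
  case (insert a A)
  then show ?case
    using hnorm_triangle[of "f a" "sum f A"] by (simp add: sum_in_H) 
qed auto

lemma family_norm_L2: "family_norm J h = L2_set (\<lambda>j. hnorm (h j)) J"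
  by (simp add: family_norm_def L2_set_def)

lemma family_norm_nonneg [simp]: "family_norm J h \<ge> 0"
  by (simp add: family_norm_L2)

lemma family_norm_power2: "(family_norm J h)\<^sup>2 = (\<Sum>j\<in>J. (hnorm (h j))\<^sup>2)"
  by (simp add: family_norm_def sum_nonneg)

lemma family_norm_triangle:
  assumes "g \<in> family_space J" "h \<in> family_space J"
  shows "family_norm J (\<lambda>j. g j + h j) \<le> family_norm J g + family_norm J h"
proof -
  have "family_norm J (\<lambda>j. g j + h j) \<le> L2_set (\<lambda>j. hnorm (g j) + hnorm (h j)) J"
    unfolding family_norm_L2
    using assms by (intro L2_set_mono hnorm_triangle) (auto simp: family_space_def add_in_H)
  also have "\<dots> \<le> family_norm J g + family_norm J h"
    unfolding family_norm_L2 by (rule L2_set_triangle_ineq)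
  finally show ?thesis .
qed

lemma family_norm_minus_commute:
  assumes "g \<in> family_space J" "h \<in> family_space J"
  shows "family_norm J (\<lambda>j. g j - h j) = family_norm J (\<lambda>j. h j - g j)"
proof -
  have "hnorm (g j - h j) = hnorm (h j - g j)" if "j \<in> J" for j
    using hnorm_scale[of "h j - g j" "-1"] that assms by (simp add: family_space_def diff_in_H)
  then show ?thesis
    by (simp add: family_norm_def)
qed

lemma hnorm_le_family_norm:
  assumes "finite J" "j \<in> J"
  shows "hnorm (h j) \<le> family_norm J h"
  unfolding family_norm_L2 using assms by (rule member_le_L2_set)

text \<open>Slicewise bounds are what makes \<open>F \<otimes> id\<close> as bounded as \<open>F\<close>.\<close>

lemma family_norm_slices_le:
  assumes "finite I" "finite J" "finite A" "C \<ge> 0"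
    and "\<And>a. a \<in> A \<Longrightarrow> family_norm I (\<lambda>i. g (i, a)) \<le> C * family_norm J (\<lambda>j. h (j, a))"
  shows "family_norm (I \<times> A) g \<le> C * family_norm (J \<times> A) h"
proof (rule power2_le_imp_le)
  have "(family_norm (I \<times> A) g)\<^sup>2 = (\<Sum>a\<in>A. (family_norm I (\<lambda>i. g (i, a)))\<^sup>2)"
    unfolding family_norm_power2 sum.cartesian_product' by (rule sum.swap)
  also have "\<dots> \<le> (\<Sum>a\<in>A. (C * family_norm J (\<lambda>j. h (j, a)))\<^sup>2)"
    by (intro sum_mono power_mono assms) auto
  also have "\<dots> = C\<^sup>2 * (\<Sum>a\<in>A. \<Sum>j\<in>J. (hnorm (h (j, a)))\<^sup>2)"
    by (simp add: power_mult_distrib family_norm_power2 sum_distrib_left)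
  also have "(\<Sum>a\<in>A. \<Sum>j\<in>J. (hnorm (h (j, a)))\<^sup>2) = (family_norm (J \<times> A) h)\<^sup>2"
    unfolding family_norm_power2 sum.cartesian_product' by (rule sum.swap)
  finally show "(family_norm (I \<times> A) g)\<^sup>2 \<le> (C * family_norm (J \<times> A) h)\<^sup>2"
    by (simp add: power_mult_distrib)
qed (use assms in simp)

lemma family_norm_swap:
  "family_norm (A \<times> J) h = family_norm (J \<times> A) (\<lambda>(j, a). h (a, j))"
  unfolding family_norm_def sum.cartesian_product' by (subst sum.swap) simp

section \<open>Monomials in commuting strict contractions\<close>

text \<open>\<open>strict_contraction\<close> without its norm bound, so that the identity qualifies
  and compositions stay inside. Everything is relative to \<open>H\<close>, because operators are
  total functions whose values off \<open>H\<close> are unknown.\<close>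

definition linear_on_H :: "('h \<Rightarrow> 'h) \<Rightarrow> bool" where
  "linear_on_H A \<longleftrightarrow>
     (\<forall>x\<in>H. A x \<in> H) \<and>
     (\<forall>x\<in>H. \<forall>y\<in>H. A (x + y) = A x + A y) \<and>
     (\<forall>c. \<forall>x\<in>H. A (scale c x) = scale c (A x))"

lemma linear_on_H_in: "linear_on_H A \<Longrightarrow> x \<in> H \<Longrightarrow> A x \<in> H"
  by (simp add: linear_on_H_def)

lemma linear_on_H_id: "linear_on_H id"
  by (simp add: linear_on_H_def)

lemma linear_on_H_comp: "linear_on_H A \<Longrightarrow> linear_on_H B \<Longrightarrow> linear_on_H (A \<circ> B)"
  by (simp add: linear_on_H_def)

lemma linear_on_H_funpow: "linear_on_H A \<Longrightarrow> linear_on_H (A ^^ m)"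
  by (induction m) (auto intro: linear_on_H_comp linear_on_H_id[unfolded id_def] simp: id_def)

lemma linear_on_H_zero: "linear_on_H A \<Longrightarrow> A 0 = 0"
  using zero_in_H unfolding linear_on_H_def by (metis scale_zero_left)

lemma linear_on_H_scale: "linear_on_H A \<Longrightarrow> x \<in> H \<Longrightarrow> A (scale c x) = scale c (A x)"
  by (simp add: linear_on_H_def)

lemma linear_on_H_diff: "linear_on_H A \<Longrightarrow> x \<in> H \<Longrightarrow> y \<in> H \<Longrightarrow> A (x - y) = A x - A y"
  by (metis linear_on_H_def diff_in_H diff_add_cancel add_diff_cancel_right')

lemma linear_on_H_sum:
  assumes "linear_on_H A" "\<And>b. b \<in> B \<Longrightarrow> f b \<in> H"
  shows "A (sum f B) = (\<Sum>b\<in>B. A (f b))"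
  using assms(2)
proof (induction B rule: infinite_finite_induct)
  case (insert b B)
  then have "sum f B \<in> H" by (intro sum_in_H) auto
  with insert show ?case using assms(1) by (simp add: linear_on_H_def)
qed (auto simp: linear_on_H_zero[OF assms(1)])

lemma funpow_commute_on:
  assumes "\<And>x. x \<in> H \<Longrightarrow> A x \<in> H" "\<And>x. x \<in> H \<Longrightarrow> B x \<in> H"
    and "\<And>x. x \<in> H \<Longrightarrow> A (B x) = B (A x)" and "x \<in> H"
  shows "A ((B ^^ m) x) = (B ^^ m) (A x)"
proof -
  \<comment> \<open>Commutation is known on \<open>H\<close> only, so the induction has to carry
    membership along.\<close>
  have "(B ^^ m) x \<in> H \<and> A ((B ^^ m) x) = (B ^^ m) (A x)"
    using assms by (induction m) auto
  then show ?thesis ..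
qed

end

locale contraction_tuple = chilbert_space scale H ip
  for scale :: "complex \<Rightarrow> 'h::ab_group_add \<Rightarrow> 'h" and H ip +
  fixes d :: nat and T :: "nat \<Rightarrow> 'h \<Rightarrow> 'h"
  assumes commuting: "commuting_strict_contractions d T"
begin

abbreviation mon :: "(nat \<Rightarrow> nat) \<Rightarrow> 'h \<Rightarrow> 'h" where
  "mon \<equiv> monomial_op d T"

lemma linear_T: "l < d \<Longrightarrow> linear_on_H (T l)"
  using commuting
  by (auto simp: commuting_strict_contractions_def strict_contraction_def linear_on_H_def)

lemma T_in_H: "l < d \<Longrightarrow> x \<in> H \<Longrightarrow> T l x \<in> H"
  using linear_T linear_on_H_in by blast

lemma T_commute: "l < d \<Longrightarrow> m < d \<Longrightarrow> x \<in> H \<Longrightarrow> T l (T m x) = T m (T l x)"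
  using commuting by (simp add: commuting_strict_contractions_def)

text \<open>\<open>monomial_op\<close> with \<open>[0..<d]\<close> replaced by an arbitrary list,
  which makes induction on the list possible.\<close>

definition mon_list :: "(nat \<Rightarrow> nat) \<Rightarrow> nat list \<Rightarrow> 'h \<Rightarrow> 'h" where
  "mon_list k ls = foldr (\<lambda>l A. (T l ^^ k l) \<circ> A) ls id"

lemma mon_list_Nil: "mon_list k [] = id"
  by (simp add: mon_list_def)

lemma mon_list_Cons: "mon_list k (l # ls) = (T l ^^ k l) \<circ> mon_list k ls"
  by (simp add: mon_list_def)

lemma monomial_op_eq: "mon k = mon_list k [0..<d]"
  by (simp add: monomial_op_def mon_list_def)

lemma mon_list_linear:
  "set ls \<subseteq> {..<d} \<Longrightarrow> linear_on_H (mon_list k ls)"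
  by (induction ls)
     (auto simp: mon_list_Nil mon_list_Cons
       intro!: linear_on_H_comp linear_on_H_id linear_on_H_funpow linear_T)

lemma linear_mon: "linear_on_H (mon k)"
  unfolding monomial_op_eq by (rule mon_list_linear) auto

lemma mon_in_H: "x \<in> H \<Longrightarrow> mon k x \<in> H"
  using linear_mon linear_on_H_in by blast

lemma mon_list_commute:
  assumes "set ls \<subseteq> {..<d}" "m < d" "x \<in> H"
  shows "mon_list k ls ((T m ^^ p) x) =
         (T m ^^ p) (mon_list k ls x)"
  using assms
proof (induction ls)
  case (Cons l ls)
  let ?A = "mon_list k ls"
  have y: "?A x \<in> H"
    using Cons.prems by (intro linear_on_H_in[OF mon_list_linear]) auto
  have "(T l ^^ k l) ((T m ^^ p) y) = (T m ^^ p) ((T l ^^ k l) y)" if "y \<in> H" for y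
  proof -
    \<comment> \<open>\<open>funpow_commute_on\<close> moves one operator past a power; the second
      application below turns this into a power past a power.\<close>
    have 1: "T l ((T m ^^ p) y) = (T m ^^ p) (T l y)" if "y \<in> H" for y
      using Cons.prems that by (intro funpow_commute_on; simp add: T_in_H T_commute[of l m])
    show ?thesis
      using Cons.prems that 1
      by (intro funpow_commute_on[where A = "T m ^^ p" and B = "T l", symmetric])
         (auto intro: T_in_H linear_on_H_in[OF linear_on_H_funpow[OF linear_T]])
  qed
  with Cons y show ?case by (simp add: mon_list_Cons)
qed (simp add: mon_list_Nil)

text \<open>Commutativity of the tuple enters the proof through this fact. It turns the composition
  of two series in \<open>T\<close> into a series in \<open>T\<close> again.\<close>

lemma mon_add:
  assumes "x \<in> H" and ab: "\<And>l. l < d \<Longrightarrow> k l = a l + b l"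
  shows "mon k x = mon a (mon b x)"
proof -
  have "mon_list k ls x =
        mon_list a ls (mon_list b ls x)"
    if "set ls \<subseteq> {..<d}" for ls
    using that
  proof (induction ls)
    case (Cons l ls)
    have "mon_list b ls x \<in> H"
      using Cons.prems assms(1) by (intro linear_on_H_in[OF mon_list_linear]) auto
    with Cons show ?case
      by (simp add: mon_list_commute[symmetric] mon_list_Cons ab funpow_add)
  qed (simp add: mon_list_Nil)
  from this[of "[0..<d]"] show ?thesis
    unfolding monomial_op_eq by (simp add: atLeast0LessThan)
qed

lemma common_ratio:
  obtains r where "0 \<le> r" "r < 1" "\<And>l x. l < d \<Longrightarrow> x \<in> H \<Longrightarrow> hnorm (T l x) \<le> r * hnorm x"
proof -
  have "\<exists>r. \<forall>l<d. r l < 1 \<and> (\<forall>x\<in>H. hnorm (T l x) \<le> r l * hnorm x)"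
    using commuting unfolding commuting_strict_contractions_def strict_contraction_def
    by (intro choice) blast
  then obtain \<rho> where \<rho>: "\<And>l. l < d \<Longrightarrow> \<rho> l < 1"
    "\<And>l x. l < d \<Longrightarrow> x \<in> H \<Longrightarrow> hnorm (T l x) \<le> \<rho> l * hnorm x" by blast
  \<comment> \<open>The inserted 0 covers \<open>d = 0\<close> and forces \<open>r\<close> to be
    nonnegative; the ratio of a single contraction may be negative when \<open>H\<close> is
    trivial.\<close>
  define r where "r = Max (insert 0 (\<rho> ` {..<d}))"
  have r: "0 \<le> r" "r < 1" "\<And>l. l < d \<Longrightarrow> \<rho> l \<le> r"
    unfolding r_def using \<rho>(1) by (auto simp: Max_ge_iff)
  show ?thesis
  proof (rule that[OF r(1,2)])
    fix l x assume "l < d" "x \<in> H"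
    then show "hnorm (T l x) \<le> r * hnorm x"
      using \<rho>(2)[of l x] mult_right_mono[OF r(3)[of l], of "hnorm x"] by simp
  qed
qed

lemma hnorm_mon_le:
  assumes "0 \<le> r" "\<And>l x. l < d \<Longrightarrow> x \<in> H \<Longrightarrow> hnorm (T l x) \<le> r * hnorm x" "x \<in> H"
  shows "hnorm (mon k x) \<le> (\<Prod>l<d. r ^ k l) * hnorm x"
proof -
  have pow: "hnorm ((T l ^^ p) y) \<le> r ^ p * hnorm y" if "l < d" "y \<in> H" for l p y
  proof (induction p)
    case (Suc p)
    have "hnorm ((T l ^^ Suc p) y) \<le> r * hnorm ((T l ^^ p) y)"
      using that by (simp add: assms(2) linear_on_H_in[OF linear_on_H_funpow[OF linear_T]])
    also have "\<dots> \<le> r * (r ^ p * hnorm y)"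
      using Suc assms(1) by (rule mult_left_mono)
    finally show ?case by (simp add: mult.assoc)
  qed simp
  have "hnorm (mon_list k ls x) \<le> (\<Prod>l\<leftarrow>ls. r ^ k l) * hnorm x"
    if "set ls \<subseteq> {..<d}" for ls
    using that
  proof (induction ls)
    case (Cons l ls)
    let ?y = "mon_list k ls x"
    have "hnorm ((T l ^^ k l) ?y) \<le> r ^ k l * hnorm ?y"
      using Cons.prems assms(3) by (intro pow linear_on_H_in[OF mon_list_linear]) auto
    also have "\<dots> \<le> r ^ k l * ((\<Prod>l\<leftarrow>ls. r ^ k l) * hnorm x)"
      using Cons assms(1) by (intro mult_left_mono) auto
    finally show ?case by (simp add: mult.assoc mon_list_Cons)
  qed (simp add: mon_list_Nil)
  from this[of "[0..<d]"] show ?thesis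
    unfolding monomial_op_eq
    by (simp add: interv_sum_list_conv_sum_set_nat prod.distinct_set_conv_list[symmetric] atLeast0LessThan)
qed

end

section \<open>Unconditional sums\<close>

text \<open>A finite set disjoint from \<open>F\<close> can add to \<open>sum w F\<close> at most
  what \<open>F\<close> still misses of the total.\<close>

lemma summable_on_tail:
  fixes w :: "'a \<Rightarrow> real"
  assumes "w summable_on A" "\<And>x. x \<in> A \<Longrightarrow> w x \<ge> 0" "e > 0"
  obtains F where "finite F" "F \<subseteq> A"
    "\<And>Z. finite Z \<Longrightarrow> Z \<subseteq> A \<Longrightarrow> Z \<inter> F = {} \<Longrightarrow> sum w Z \<le> e"
proof -
  have hs: "(w has_sum infsum w A) A"
    using assms(1) by (rule has_sum_infsum)
  obtain F where F: "finite F" "F \<subseteq> A" "dist (sum w F) (infsum w A) \<le> e"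
    using has_sum_finite_approximation[OF hs assms(3)] by blast
  show ?thesis
  proof (rule that[OF F(1,2)])
    fix Z assume Z: "finite Z" "Z \<subseteq> A" "Z \<inter> F = {}"
    have "sum w Z + sum w F = sum w (Z \<union> F)"
      using Z F by (simp add: sum.union_disjoint)
    also have "\<dots> \<le> infsum w A"
      using Z F assms by (intro finite_sum_le_infsum) auto
    finally show "sum w Z \<le> e"
      using F(3) by (auto simp: dist_real_def)
  qed
qed

text \<open>Every finite set of pairs lies in the rectangle of its two projections, and the sum over
  a rectangle factors.\<close>

lemma summable_on_product:
  fixes u :: "'a \<Rightarrow> real" and v :: "'b \<Rightarrow> real"
  assumes "u summable_on A" "v summable_on B"
    and "\<And>a. a \<in> A \<Longrightarrow> u a \<ge> 0" "\<And>b. b \<in> B \<Longrightarrow> v b \<ge> 0"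
  shows "(\<lambda>(a, b). u a * v b) summable_on A \<times> B"
proof (rule nonneg_bdd_above_summable_on)
  show "bdd_above (sum (\<lambda>(a, b). u a * v b) ` {F. F \<subseteq> A \<times> B \<and> finite F})"
  proof (rule bdd_aboveI2)
    fix Z assume "Z \<in> {F. F \<subseteq> A \<times> B \<and> finite F}"
    then have Z: "Z \<subseteq> A \<times> B" "finite Z" by auto
    then have sub: "fst ` Z \<subseteq> A" "snd ` Z \<subseteq> B" "Z \<subseteq> fst ` Z \<times> snd ` Z" by force+
    have nn: "sum u (fst ` Z) \<ge> 0" "sum v (snd ` Z) \<ge> 0" "infsum v B \<ge> 0" "infsum u A \<ge> 0"
      using sub assms by (auto intro!: sum_nonneg infsum_nonneg)
    have "(\<Sum>(a, b)\<in>Z. u a * v b) \<le> (\<Sum>(a, b)\<in>fst ` Z \<times> snd ` Z. u a * v b)"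
      using Z sub assms by (intro sum_mono2) (auto intro!: mult_nonneg_nonneg)
    also have "\<dots> = sum u (fst ` Z) * sum v (snd ` Z)"
      by (simp add: sum_product sum.cartesian_product)
    also have "\<dots> \<le> infsum u A * infsum v B"
      using Z sub assms nn by (intro mult_mono finite_sum_le_infsum) auto
    finally show "(\<Sum>(a, b)\<in>Z. u a * v b) \<le> infsum u A * infsum v B" .
  qed
qed (use assms in auto)

text \<open>Unconditional summability in the complex numbers is absolute; this supplies the joint
  summability without which iterated sums do not determine the double sum.\<close>

lemma has_sum_product_complex:
  fixes u :: "'a \<Rightarrow> complex" and v :: "'b \<Rightarrow> complex"
  assumes u: "(u has_sum x) A" and v: "(v has_sum y) B"
  shows "((\<lambda>(a, b). u a * v b) has_sum (x * y)) (A \<times> B)"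
proof (rule has_sum_SigmaI)
  show "((\<lambda>b. case (a, b) of (a, b) \<Rightarrow> u a * v b) has_sum (u a * y)) B" for a
    using has_sum_cmult_right[OF v] by simp
  show "((\<lambda>a. u a * y) has_sum (x * y)) A"
    using has_sum_cmult_left[OF u] by simp
  have "(\<lambda>a. norm (u a)) summable_on A" "(\<lambda>b. norm (v b)) summable_on B"
    using u v summable_on_iff_abs_summable_on_complex summable_on_def by blast+
  then have "(\<lambda>(a, b). norm (u a) * norm (v b)) summable_on A \<times> B"
    by (rule summable_on_product) auto
  then show "(\<lambda>(a, b). u a * v b) summable_on A \<times> B"
    by (simp add: summable_on_iff_abs_summable_on_complex case_prod_unfold norm_mult)
qed

lemma has_sum_finite_sum:
  fixes f :: "'a \<Rightarrow> 'b \<Rightarrow> 'c::topological_comm_monoid_add"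
  assumes "\<And>i. i \<in> I \<Longrightarrow> (f i has_sum s i) A"
  shows "((\<lambda>x. \<Sum>i\<in>I. f i x) has_sum (\<Sum>i\<in>I. s i)) A"
  using assms by (induction I rule: infinite_finite_induct) (auto intro: has_sum_add)

lemma summable_on_finite_sum:
  fixes f :: "'a \<Rightarrow> 'b \<Rightarrow> 'c::topological_comm_monoid_add"
  assumes "\<And>i. i \<in> I \<Longrightarrow> f i summable_on A"
  shows "(\<lambda>x. \<Sum>i\<in>I. f i x) summable_on A"
  using assms by (induction I rule: infinite_finite_induct) (auto intro: summable_on_add)

section \<open>Kronecker products\<close>

text \<open>The restricted lambda is needed because \<open>multi_indices d\<close> consists of
  extensional functions, which are \<open>undefined\<close> from \<open>d\<close> on.\<close>

definition index_add :: "nat \<Rightarrow> (nat \<Rightarrow> nat) \<Rightarrow> (nat \<Rightarrow> nat) \<Rightarrow> nat \<Rightarrow> nat" where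
  "index_add d a b = (\<lambda>l\<in>{..<d}. a l + b l)"

definition index_splits :: "nat \<Rightarrow> (nat \<Rightarrow> nat) \<Rightarrow> ((nat \<Rightarrow> nat) \<times> (nat \<Rightarrow> nat)) set" where
  "index_splits d k = {(a, b) \<in> multi_indices d \<times> multi_indices d. index_add d a b = k}"

lemma index_add_in: "index_add d a b \<in> multi_indices d"
  by (simp add: index_add_def multi_indices_def)

lemma finite_index_splits: "finite (index_splits d k)"
proof (rule finite_subset)
  let ?B = "PiE {..<d} (\<lambda>l. {..k l})"
  show "index_splits d k \<subseteq> ?B \<times> ?B"
    by (auto simp: index_splits_def index_add_def multi_indices_def PiE_iff extensional_def)
  show "finite (?B \<times> ?B)"
    by (intro finite_cartesian_product finite_PiE) auto
qed

definition kronecker :: "('i \<Rightarrow> 'j \<Rightarrow> complex) \<Rightarrow> ('a \<Rightarrow> 'b \<Rightarrow> complex) \<Rightarrow> 'i \<times> 'a \<Rightarrow> 'j \<times> 'b \<Rightarrow> complex"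
  where "kronecker A B p q = A (fst p) (fst q) * B (snd p) (snd q)"

text \<open>The coefficients of a Cauchy product, with \<open>kronecker\<close> as the
  multiplication.\<close>

definition kronecker_coeff ::
  "nat \<Rightarrow> ((nat \<Rightarrow> nat) \<Rightarrow> 'i \<Rightarrow> 'j \<Rightarrow> complex) \<Rightarrow> ((nat \<Rightarrow> nat) \<Rightarrow> 'a \<Rightarrow> 'b \<Rightarrow> complex) \<Rightarrow>
   (nat \<Rightarrow> nat) \<Rightarrow> 'i \<times> 'a \<Rightarrow> 'j \<times> 'b \<Rightarrow> complex"
  where "kronecker_coeff d c c' k p q = (\<Sum>(a, b)\<in>index_splits d k. kronecker (c a) (c' b) p q)"

text \<open>The product series over all pairs of multi-indices is summed along antidiagonals:
  labelling each pair with its sum is a bijection onto the disjoint union of the finite sets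
  \<open>index_splits d k\<close>.\<close>

lemma has_power_series_kronecker:
  assumes "has_power_series d J I f c" "has_power_series d J' I' g c'"
  shows "has_power_series d (J \<times> J') (I \<times> I') (\<lambda>z. kronecker (f z) (g z)) (kronecker_coeff d c c')"
  unfolding has_power_series_def
proof (intro ballI)
  fix z p q
  assume z: "z \<in> polydisc d" and "p \<in> I \<times> I'" "q \<in> J \<times> J'"
  then obtain i i' j j' where pq: "p = (i, i')" "q = (j, j')" "i \<in> I" "i' \<in> I'" "j \<in> J" "j' \<in> J'"
    by auto
  define t where "t a b = c a i j * (\<Prod>l<d. z l ^ a l) * (c' b i' j' * (\<Prod>l<d. z l ^ b l))" for a b
  define M where "M = multi_indices d"
  have prod: "((\<lambda>(a, b). t a b) has_sum f z i j * g z i' j') (M \<times> M)"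
    unfolding t_def M_def using assms z pq
    by (intro has_sum_product_complex) (auto simp: has_power_series_def)
  have "bij_betw (\<lambda>(a, b). (index_add d a b, a, b)) (M \<times> M) (Sigma M (index_splits d))"
    by (rule bij_betw_byWitness[where f' = snd]) (auto simp: index_splits_def M_def index_add_in)
  from has_sum_reindex_bij_betw[OF this, of "\<lambda>(k, a, b). t a b"]
  have "((\<lambda>(k, a, b). t a b) has_sum f z i j * g z i' j') (Sigma M (index_splits d))"
    using prod by (simp add: case_prod_unfold)
  then have "((\<lambda>k. \<Sum>(a, b)\<in>index_splits d k. t a b) has_sum f z i j * g z i' j') M"
  proof (rule has_sum_SigmaD)
    fix k
    show "((\<lambda>y. case (k, y) of (k, a, b) \<Rightarrow> t a b) has_sum (\<Sum>(a, b)\<in>index_splits d k. t a b))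
            (index_splits d k)"
      using has_sum_finite[OF finite_index_splits] by simp
  qed
  moreover have "(\<Sum>(a, b)\<in>index_splits d k. t a b) = kronecker_coeff d c c' k p q * (\<Prod>l<d. z l ^ k l)"
    for k
    unfolding kronecker_coeff_def sum_distrib_right
    by (intro sum.cong)
       (auto simp: index_splits_def index_add_def t_def kronecker_def pq power_add prod.distrib)
  ultimately show "((\<lambda>k. kronecker_coeff d c c' k p q * (\<Prod>l<d. z l ^ k l)) has_sum
      kronecker (f z) (g z) p q) (multi_indices d)"
    by (simp add: M_def kronecker_def pq)
qed

text \<open>Evaluation at the point of the polydisc all of whose coordinates are \<open>r\<close>.
  Together with \<open>hnorm_mon_le\<close> this majorises the operator series.\<close>

lemma has_power_series_abs_summable:
  assumes "has_power_series d J I f c" "i \<in> I" "j \<in> J" "0 \<le> r" "r < 1"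
  shows "(\<lambda>k. cmod (c k i j) * (\<Prod>l<d. r ^ k l)) summable_on multi_indices d"
proof -
  define z where "z = (\<lambda>l\<in>{..<d}. complex_of_real r)"
  have "z \<in> polydisc d"
    using assms(4,5) by (auto simp: z_def polydisc_def)
  then have "(\<lambda>k. c k i j * (\<Prod>l<d. z l ^ k l)) summable_on multi_indices d"
    using assms(1-3) unfolding has_power_series_def summable_on_def by blast
  then have "(\<lambda>k. norm (c k i j * (\<Prod>l<d. z l ^ k l))) summable_on multi_indices d"
    by (simp add: summable_on_iff_abs_summable_on_complex)
  moreover have "norm (c k i j * (\<Prod>l<d. z l ^ k l)) = cmod (c k i j) * (\<Prod>l<d. r ^ k l)" for k
    using assms(4) by (simp add: z_def norm_mult norm_power flip: prod_norm)
  ultimately show ?thesis by simp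
qed

section \<open>Operator value of a Kronecker product\<close>

context chilbert_space
begin

lemma family_norm_slices_le':
  assumes "finite I" "finite J" "finite A" "C \<ge> 0"
    and "\<And>a. a \<in> A \<Longrightarrow> family_norm I (\<lambda>i. g (a, i)) \<le> C * family_norm J (\<lambda>j. h (a, j))"
  shows "family_norm (A \<times> I) g \<le> C * family_norm (A \<times> J) h"
  unfolding family_norm_swap[of A]
  using assms by (intro family_norm_slices_le) auto

definition partial_value ::
  "nat \<Rightarrow> 'j set \<Rightarrow> ((nat \<Rightarrow> nat) \<Rightarrow> 'i \<Rightarrow> 'j \<Rightarrow> complex) \<Rightarrow> (nat \<Rightarrow> 'h \<Rightarrow> 'h)
     \<Rightarrow> (nat \<Rightarrow> nat) set \<Rightarrow> ('j \<Rightarrow> 'h) \<Rightarrow> 'i \<Rightarrow> 'h" where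
  "partial_value d J c T K h i = (\<Sum>k\<in>K. matrix_tensor J (c k) (monomial_op d T k) h i)"

lemma has_operator_value_iff:
  "has_operator_value d J I c T F \<longleftrightarrow>
     (\<forall>h\<in>family_space J. F h \<in> family_space I) \<and>
     (\<forall>e>0. \<exists>K0. finite K0 \<and> K0 \<subseteq> multi_indices d \<and>
       (\<forall>K. finite K \<and> K0 \<subseteq> K \<and> K \<subseteq> multi_indices d \<longrightarrow>
        (\<forall>h\<in>family_space J. family_norm I (\<lambda>i. F h i - partial_value d J c T K h i)
            \<le> e * family_norm J h)))"
  unfolding has_operator_value_def partial_value_def eventually_finite_subsets_at_top by blast

lemma has_operator_valueE:
  assumes "has_operator_value d J I c T F" "e > 0"
  obtains K0 where "finite K0" "K0 \<subseteq> multi_indices d"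
    "\<And>K h. finite K \<Longrightarrow> K0 \<subseteq> K \<Longrightarrow> K \<subseteq> multi_indices d \<Longrightarrow> h \<in> family_space J \<Longrightarrow>
       family_norm I (\<lambda>i. F h i - partial_value d J c T K h i) \<le> e * family_norm J h"
proof -
  obtain K0 where "finite K0 \<and> K0 \<subseteq> multi_indices d \<and>
       (\<forall>K. finite K \<and> K0 \<subseteq> K \<and> K \<subseteq> multi_indices d \<longrightarrow>
        (\<forall>h\<in>family_space J. family_norm I (\<lambda>i. F h i - partial_value d J c T K h i)
            \<le> e * family_norm J h))"
    using assms unfolding has_operator_value_iff by (elim conjE allE[of _ e]) auto
  then show thesis
    by (intro that[of K0]) simp_all
qed

end

context contraction_tuple
begin

abbreviation partial :: "'j set \<Rightarrow> ((nat \<Rightarrow> nat) \<Rightarrow> 'i \<Rightarrow> 'j \<Rightarrow> complex)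
     \<Rightarrow> (nat \<Rightarrow> nat) set \<Rightarrow> ('j \<Rightarrow> 'h) \<Rightarrow> 'i \<Rightarrow> 'h" where
  "partial J c \<equiv> partial_value d J c T"

lemma partial_in_H: "h \<in> family_space J \<Longrightarrow> partial J c K h i \<in> H"
  unfolding partial_value_def matrix_tensor_def family_space_def
  by (auto intro!: sum_in_H scale_in_H mon_in_H)

lemma partial_diff:
  assumes "g \<in> family_space J" "h \<in> family_space J"
  shows "partial J c K (\<lambda>j. g j - h j) i = partial J c K g i - partial J c K h i"
  using assms
  by (simp add: partial_value_def matrix_tensor_def family_space_def linear_on_H_diff[OF linear_mon]
      scale_right_diff_distrib sum_subtractf)

text \<open>Partial sums of \<open>F\<close> need not be contractions. Nearness to one yields the
  factor \<open>1 + e\<close>, with which the outer partial sum can act on the truncation error of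
  the inner series.\<close>

lemma partial_norm_le:
  assumes "F x \<in> family_space I" "x \<in> family_space J"
    and "family_norm I (F x) \<le> family_norm J x"
    and "family_norm I (\<lambda>i. F x i - partial J c K x i) \<le> e * family_norm J x"
  shows "family_norm I (partial J c K x) \<le> (1 + e) * family_norm J x"
proof -
  let ?P = "partial J c K x"
  have P: "?P \<in> family_space I" "(\<lambda>i. ?P i - F x i) \<in> family_space I"
    using assms by (auto simp: family_space_def intro!: diff_in_H partial_in_H)
  have "family_norm I (\<lambda>i. F x i + (?P i - F x i)) \<le> family_norm I (F x) + family_norm I (\<lambda>i. ?P i - F x i)"
    using P assms by (intro family_norm_triangle)
  also have "family_norm I (\<lambda>i. ?P i - F x i) = family_norm I (\<lambda>i. F x i - ?P i)"
    using P assms by (intro family_norm_minus_commute)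
  finally show ?thesis
    using assms by (simp add: algebra_simps)
qed

text \<open>The contribution of one exponent pair to the entry \<open>p\<close>. The next two lemmas
  write the regrouped partial sum and the composed partial sums as sums of this same term over
  different sets of pairs, so that they can be compared.\<close>

definition kronecker_term where
  "kronecker_term J J' c c' h p = (\<lambda>(a, b). \<Sum>q\<in>J \<times> J'. scale (kronecker (c a) (c' b) p q) (mon a (mon b (h q))))"

text \<open>The antidiagonals are disjoint, since a pair determines its sum, and
  \<open>mon_add\<close> splits each monomial.\<close>

lemma partial_kronecker_coeff:
  assumes "finite K" "h \<in> family_space (J \<times> J')"
  shows "partial (J \<times> J') (kronecker_coeff d c c') K h p =
         (\<Sum>z\<in>(\<Union>k\<in>K. index_splits d k). kronecker_term J J' c c' h p z)"
proof -
  have "matrix_tensor (J \<times> J') (kronecker_coeff d c c' k) (mon k) h p =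
        (\<Sum>z\<in>index_splits d k. kronecker_term J J' c c' h p z)" for k
  proof -
    have "matrix_tensor (J \<times> J') (kronecker_coeff d c c' k) (mon k) h p =
          (\<Sum>(a, b)\<in>index_splits d k. \<Sum>q\<in>J \<times> J'. scale (kronecker (c a) (c' b) p q) (mon k (h q)))"
      unfolding matrix_tensor_def kronecker_coeff_def scale_sum_left case_prod_unfold by (rule sum.swap)
    also have "\<dots> = (\<Sum>z\<in>index_splits d k. kronecker_term J J' c c' h p z)"
      using assms(2)
      by (intro sum.cong)
         (auto simp: kronecker_term_def index_splits_def family_space_def index_add_def
           intro!: sum.cong arg_cong[where f = "scale _"] mon_add)
    finally show ?thesis .
  qed
  then show ?thesis
    unfolding partial_value_def
    using assms(1) finite_index_splits
    by (subst sum.UNION_disjoint) (auto simp: index_splits_def)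
qed

lemma partial_partial:
  assumes "h \<in> family_space (J \<times> J')"
  shows "partial J c K (\<lambda>j. partial J' c' L (\<lambda>j'. h (j, j')) i') i =
         (\<Sum>z\<in>K \<times> L. kronecker_term J J' c c' h (i, i') z)"
proof -
  have h: "h (j, j') \<in> H" if "j \<in> J" "j' \<in> J'" for j j'
    using assms that by (auto simp: family_space_def)
  have "partial J c K (\<lambda>j. partial J' c' L (\<lambda>j'. h (j, j')) i') i =
        (\<Sum>a\<in>K. \<Sum>j\<in>J. \<Sum>b\<in>L. \<Sum>j'\<in>J'. scale (c a i j * c' b i' j') (mon a (mon b (h (j, j')))))"
    unfolding partial_value_def matrix_tensor_def
    using h
    by (simp add: linear_on_H_sum[OF linear_mon] linear_on_H_scale[OF linear_mon] sum_in_H scale_in_H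
        mon_in_H scale_sum_right)
  also have "\<dots> = (\<Sum>a\<in>K. \<Sum>b\<in>L. \<Sum>j\<in>J. \<Sum>j'\<in>J'. scale (c a i j * c' b i' j') (mon a (mon b (h (j, j')))))"
    by (intro sum.cong refl sum.swap)
  finally show ?thesis
    by (simp add: kronecker_term_def kronecker_def sum.cartesian_product')
qed

text \<open>The bound separates into a weight of \<open>a\<close> and a weight of \<open>b\<close>,
  each summable. Taking the sum over all matrix entries makes the weights independent of
  \<open>p\<close>.\<close>

lemma hnorm_kronecker_term_le:
  assumes r: "0 \<le> r" "\<And>l x. l < d \<Longrightarrow> x \<in> H \<Longrightarrow> hnorm (T l x) \<le> r * hnorm x"
    and fin: "finite I" "finite J" "finite I'" "finite J'" and p: "p \<in> I \<times> I'"
    and h: "h \<in> family_space (J \<times> J')"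
  shows "hnorm (kronecker_term J J' c c' h p (a, b)) \<le>
         ((\<Sum>i\<in>I. \<Sum>j\<in>J. cmod (c a i j)) * (\<Prod>l<d. r ^ a l)) *
         ((\<Sum>i\<in>I'. \<Sum>j\<in>J'. cmod (c' b i j)) * (\<Prod>l<d. r ^ b l)) * family_norm (J \<times> J') h"
proof -
  obtain i i' where i: "p = (i, i')" "i \<in> I" "i' \<in> I'"
    using p by auto
  define \<rho> where "\<rho> k = (\<Prod>l<d. r ^ k l)" for k
  have \<rho>: "\<rho> k \<ge> 0" for k
    unfolding \<rho>_def using r(1) by (intro prod_nonneg) auto
  have mon: "hnorm (mon a (mon b (h q))) \<le> \<rho> a * \<rho> b * family_norm (J \<times> J') h" if q: "q \<in> J \<times> J'" for q
  proof -
    have hq: "h q \<in> H" using h q by (auto simp: family_space_def)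
    have "hnorm (mon a (mon b (h q))) \<le> \<rho> a * hnorm (mon b (h q))"
      unfolding \<rho>_def using r hq by (intro hnorm_mon_le mon_in_H)
    also have "\<dots> \<le> \<rho> a * (\<rho> b * hnorm (h q))"
      using hnorm_mon_le[OF r hq, of b] \<rho> by (intro mult_left_mono) (auto simp: \<rho>_def)
    also have "\<dots> \<le> \<rho> a * (\<rho> b * family_norm (J \<times> J') h)"
      using q fin \<rho> by (intro mult_left_mono hnorm_le_family_norm) auto
    finally show ?thesis by (simp add: mult.assoc)
  qed
  have "hnorm (kronecker_term J J' c c' h p (a, b)) \<le>
        (\<Sum>q\<in>J \<times> J'. hnorm (scale (kronecker (c a) (c' b) p q) (mon a (mon b (h q)))))"
    unfolding kronecker_term_def prod.case
    using h by (intro hnorm_sum_le scale_in_H mon_in_H) (auto simp: family_space_def)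
  also have "\<dots> \<le> (\<Sum>q\<in>J \<times> J'. cmod (kronecker (c a) (c' b) p q) * (\<rho> a * \<rho> b * family_norm (J \<times> J') h))"
  proof (rule sum_mono)
    fix q assume q: "q \<in> J \<times> J'"
    then have "mon a (mon b (h q)) \<in> H"
      using h by (intro mon_in_H) (auto simp: family_space_def)
    then show "hnorm (scale (kronecker (c a) (c' b) p q) (mon a (mon b (h q)))) \<le>
        cmod (kronecker (c a) (c' b) p q) * (\<rho> a * \<rho> b * family_norm (J \<times> J') h)"
      using mon[OF q] by (simp add: hnorm_scale mult_left_mono)
  qed
  also have "\<dots> = (\<Sum>j\<in>J. cmod (c a i j)) * (\<Sum>j'\<in>J'. cmod (c' b i' j')) * (\<rho> a * \<rho> b * family_norm (J \<times> J') h)"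
    unfolding sum_distrib_right[symmetric]
    by (simp add: i kronecker_def norm_mult sum_product sum.cartesian_product')
  also have "\<dots> \<le> (\<Sum>i\<in>I. \<Sum>j\<in>J. cmod (c a i j)) * (\<Sum>i'\<in>I'. \<Sum>j'\<in>J'. cmod (c' b i' j')) *
      (\<rho> a * \<rho> b * family_norm (J \<times> J') h)"
    using i fin \<rho>
    by (intro mult_right_mono mult_mono mult_nonneg_nonneg sum_nonneg
        member_le_sum[where f = "\<lambda>i. \<Sum>j\<in>J. cmod (c a i j)"]
        member_le_sum[where f = "\<lambda>i. \<Sum>j\<in>J'. cmod (c' b i j)"]) auto
  finally show ?thesis
    by (simp add: \<rho>_def mult_ac)
qed

end

context contraction_tuple
begin

text \<open>\<open>E\<close> is \<open>F\<close> on the first factor after \<open>G\<close> on the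
  second, hence a product of two contractions. Convergence is shown by passing from
  \<open>E h\<close> to the regrouped partial sum \<open>P\<close> in three stages: truncate the
  outer series (\<open>FX\<close>), truncate the inner series (\<open>FY\<close>), and exchange the
  rectangle of exponent pairs for a union of antidiagonals.\<close>

lemma has_operator_value_kronecker:
  assumes fin: "finite I" "finite J" "finite I'" "finite J'"
    and f: "has_power_series d J I f c" and g: "has_power_series d J' I' g c'"
    and F: "has_operator_value d J I c T F"
      "\<And>h. h \<in> family_space J \<Longrightarrow> family_norm I (F h) \<le> family_norm J h"
    and G: "has_operator_value d J' I' c' T G"
      "\<And>h. h \<in> family_space J' \<Longrightarrow> family_norm I' (G h) \<le> family_norm J' h"
  defines "E \<equiv> \<lambda>h (i, i'). F (\<lambda>j. G (\<lambda>j'. h (j, j')) i') i"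
  shows "has_operator_value d (J \<times> J') (I \<times> I') (kronecker_coeff d c c') T E"
    and "\<And>h. h \<in> family_space (J \<times> J') \<Longrightarrow> family_norm (I \<times> I') (E h) \<le> family_norm (J \<times> J') h"
proof -
  have F_in: "F h \<in> family_space I" if "h \<in> family_space J" for h
    using F(1) that by (simp add: has_operator_value_def)
  have G_in: "G h \<in> family_space I'" if "h \<in> family_space J'" for h
    using G(1) that by (simp add: has_operator_value_def)
  \<comment> \<open>The intermediate vector: \<open>G\<close> applied to the second index, the first
    index being a spectator.\<close>
  define X where "X h = (\<lambda>(j, i'). G (\<lambda>j'. h (j, j')) i')" for h :: "'b \<times> 'd \<Rightarrow> 'h"
  have slice: "(\<lambda>j'. h (j, j')) \<in> family_space J'" if "h \<in> family_space (J \<times> J')" "j \<in> J" for h j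
    using that by (auto simp: family_space_def)
  have X_in: "(\<lambda>j. X h (j, i')) \<in> family_space J" if "h \<in> family_space (J \<times> J')" "i' \<in> I'" for h i'
    using G_in[OF slice[OF that(1)]] that(2) by (auto simp: family_space_def X_def)
  have X_norm: "family_norm (J \<times> I') (X h) \<le> family_norm (J \<times> J') h" if "h \<in> family_space (J \<times> J')" for h
    using family_norm_slices_le'[of I' J' J 1 "X h" h] G(2)[OF slice[OF that]] fin
    by (simp add: X_def)
  have E_eq: "E h (i, i') = F (\<lambda>j. X h (j, i')) i" for h i i'
    by (simp add: E_def X_def)
  show "family_norm (I \<times> I') (E h) \<le> family_norm (J \<times> J') h" if "h \<in> family_space (J \<times> J')" for h
  proof -
    have "family_norm (I \<times> I') (E h) \<le> family_norm (J \<times> I') (X h)"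
      using family_norm_slices_le[of I J I' 1 "E h" "X h"] F(2)[OF X_in[OF that]] fin
      by (simp add: E_eq)
    with X_norm[OF that] show ?thesis by simp
  qed
  show "has_operator_value d (J \<times> J') (I \<times> I') (kronecker_coeff d c c') T E"
    unfolding has_operator_value_iff
  proof (intro conjI allI impI ballI)
    fix h assume "h \<in> family_space (J \<times> J')"
    then show "E h \<in> family_space (I \<times> I')"
      using F_in[OF X_in] by (auto simp: family_space_def E_eq)
  next
    fix e :: real assume e: "e > 0"
    define N where "N = real (card (I \<times> I'))"
    \<comment> \<open>The three stages cost \<epsilon>, 2\<epsilon> and N\<epsilon> times the norm
      of \<open>h\<close>. The 2 bounds \<open>1 + \<epsilon>\<close>, whence the minimum with 1;
      \<open>N\<close> counts the entries, since the last stage is estimated entry by entry.\<close>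
    define \<epsilon> where "\<epsilon> = min 1 (e / (3 + N))"
    have \<epsilon>: "\<epsilon> > 0" "\<epsilon> \<le> 1" "\<epsilon> * (3 + N) \<le> e"
      using e by (auto simp: \<epsilon>_def N_def min_def field_simps add_pos_nonneg)
    define M where "M = multi_indices d"
    obtain r where r: "0 \<le> r" "r < 1" "\<And>l x. l < d \<Longrightarrow> x \<in> H \<Longrightarrow> hnorm (T l x) \<le> r * hnorm x"
      by (rule common_ratio) blast
    \<comment> \<open>The weights of \<open>hnorm_kronecker_term_le\<close>: a term is at most
      \<open>u a * v b\<close> times the norm of \<open>h\<close>.\<close>
    define u where "u a = (\<Sum>i\<in>I. \<Sum>j\<in>J. cmod (c a i j)) * (\<Prod>l<d. r ^ a l)" for a
    define v where "v b = (\<Sum>i\<in>I'. \<Sum>j\<in>J'. cmod (c' b i j)) * (\<Prod>l<d. r ^ b l)" for b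
    have nonneg: "u a \<ge> 0" "v a \<ge> 0" for a
      unfolding u_def v_def using r(1) by (auto intro!: mult_nonneg_nonneg sum_nonneg prod_nonneg)
    have "u summable_on M"
      unfolding u_def sum_distrib_right M_def
      by (intro summable_on_finite_sum has_power_series_abs_summable[OF f _ _ r(1,2)])
    moreover have "v summable_on M"
      unfolding v_def sum_distrib_right M_def
      by (intro summable_on_finite_sum has_power_series_abs_summable[OF g _ _ r(1,2)])
    ultimately have "(\<lambda>(a, b). u a * v b) summable_on M \<times> M"
      using nonneg by (intro summable_on_product)
    moreover have "(case x of (a, b) \<Rightarrow> u a * v b) \<ge> 0" for x
      using nonneg by (cases x) simp
    ultimately obtain Z0 where Z0: "finite Z0" "Z0 \<subseteq> M \<times> M"
      and tail: "\<And>Z. finite Z \<Longrightarrow> Z \<subseteq> M \<times> M \<Longrightarrow> Z \<inter> Z0 = {} \<Longrightarrow> (\<Sum>(a, b)\<in>Z. u a * v b) \<le> \<epsilon>"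
      by (rule summable_on_tail[OF _ _ \<epsilon>(1)]) blast
    obtain K0 where K0: "finite K0" "K0 \<subseteq> M"
      "\<And>K h. finite K \<Longrightarrow> K0 \<subseteq> K \<Longrightarrow> K \<subseteq> M \<Longrightarrow> h \<in> family_space J \<Longrightarrow>
         family_norm I (\<lambda>i. F h i - partial J c K h i) \<le> \<epsilon> * family_norm J h"
      unfolding M_def by (rule has_operator_valueE[OF F(1) \<epsilon>(1)]) blast
    obtain L0 where L0: "finite L0" "L0 \<subseteq> M"
      "\<And>K h. finite K \<Longrightarrow> L0 \<subseteq> K \<Longrightarrow> K \<subseteq> M \<Longrightarrow> h \<in> family_space J' \<Longrightarrow>
         family_norm I' (\<lambda>i. G h i - partial J' c' K h i) \<le> \<epsilon> * family_norm J' h"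
      unfolding M_def by (rule has_operator_valueE[OF G(1) \<epsilon>(1)]) blast
    \<comment> \<open>Enlarged so that the rectangle \<open>K1 \<times> L1\<close> swallows
      \<open>Z0\<close>; pairs outside it then belong to the tail.\<close>
    define K1 L1 where "K1 = K0 \<union> fst ` Z0" and "L1 = L0 \<union> snd ` Z0"
    have KL: "finite K1" "K0 \<subseteq> K1" "K1 \<subseteq> M" "finite L1" "L0 \<subseteq> L1" "L1 \<subseteq> M" "Z0 \<subseteq> K1 \<times> L1"
      using K0 L0 Z0 by (auto simp: K1_def L1_def rev_image_eqI)
    show "\<exists>K0. finite K0 \<and> K0 \<subseteq> multi_indices d \<and>
       (\<forall>K. finite K \<and> K0 \<subseteq> K \<and> K \<subseteq> multi_indices d \<longrightarrow>
        (\<forall>h\<in>family_space (J \<times> J').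
          family_norm (I \<times> I') (\<lambda>i. E h i - partial (J \<times> J') (kronecker_coeff d c c') K h i)
            \<le> e * family_norm (J \<times> J') h))"
    \<comment> \<open>Once \<open>K\<close> contains all sums of pairs from the rectangle, its
      antidiagonals cover the rectangle.\<close>
    proof (intro exI[of _ "(\<lambda>(a, b). index_add d a b) ` (K1 \<times> L1)"] conjI allI impI ballI; (elim conjE)?)
      show "finite ((\<lambda>(a, b). index_add d a b) ` (K1 \<times> L1))"
        using KL by simp
      show "(\<lambda>(a, b). index_add d a b) ` (K1 \<times> L1) \<subseteq> multi_indices d"
        by (auto simp: index_add_in)
    next
      fix K h
      assume K: "finite K" "(\<lambda>(a, b). index_add d a b) ` (K1 \<times> L1) \<subseteq> K" "K \<subseteq> multi_indices d"
        and h: "h \<in> family_space (J \<times> J')"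
      define n where "n = family_norm (J \<times> J') h"
      have n: "n \<ge> 0" by (simp add: n_def)
      define Y where "Y = (\<lambda>(j, i'). partial J' c' L1 (\<lambda>j'. h (j, j')) i')"
      define P where "P = partial (J \<times> J') (kronecker_coeff d c c') K h"
      define FX where "FX = (\<lambda>(i, i'). partial J c K1 (\<lambda>j. X h (j, i')) i)"
      define FY where "FY = (\<lambda>(i, i'). partial J c K1 (\<lambda>j. Y (j, i')) i)"
      have Y_in: "(\<lambda>j. Y (j, i')) \<in> family_space J" for i'
        using partial_in_H[OF slice[OF h]] by (auto simp: family_space_def Y_def)
      have spaces: "E h \<in> family_space (I \<times> I')" "FX \<in> family_space (I \<times> I')"
        "FY \<in> family_space (I \<times> I')" "P \<in> family_space (I \<times> I')"
        using F_in[OF X_in[OF h]] partial_in_H[OF h] partial_in_H[OF Y_in] partial_in_H[OF X_in[OF h]]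
        by (auto simp: family_space_def E_eq FX_def FY_def P_def)
      have 1: "family_norm (I \<times> I') (\<lambda>p. E h p - FX p) \<le> \<epsilon> * n"
      proof -
        have "family_norm (I \<times> I') (\<lambda>p. E h p - FX p) \<le> \<epsilon> * family_norm (J \<times> I') (X h)"
          using fin \<epsilon> K0(3)[OF KL(1-3) X_in[OF h]]
          by (intro family_norm_slices_le) (auto simp: E_eq FX_def)
        also have "\<dots> \<le> \<epsilon> * n"
          using \<epsilon> X_norm[OF h] by (simp add: n_def)
        finally show ?thesis .
      qed
      have 2: "family_norm (I \<times> I') (\<lambda>p. FX p - FY p) \<le> 2 * \<epsilon> * n"
      proof -
        have "family_norm (I \<times> I') (\<lambda>p. FX p - FY p)
            \<le> (1 + \<epsilon>) * family_norm (J \<times> I') (\<lambda>q. X h q - Y q)"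
        proof (rule family_norm_slices_le)
          fix i' assume i': "i' \<in> I'"
          let ?x = "\<lambda>j. X h (j, i') - Y (j, i')"
          have x: "?x \<in> family_space J"
            using X_in[OF h i'] Y_in[of i'] by (simp add: family_space_def diff_in_H)
          \<comment> \<open>By linearity the difference of \<open>FX\<close> and \<open>FY\<close>
            is one partial sum applied to \<open>X - Y\<close>, so the bound
            \<open>1 + \<epsilon>\<close> applies to the inner error.\<close>
          have "family_norm I (partial J c K1 ?x) \<le> (1 + \<epsilon>) * family_norm J ?x"
            using F(2)[OF x] F_in[OF x] x K0(3)[OF KL(1-3) x] by (intro partial_norm_le[of F])
          then show "family_norm I (\<lambda>i. FX (i, i') - FY (i, i')) \<le> (1 + \<epsilon>) * family_norm J ?x"
            unfolding FX_def FY_def prod.case partial_diff[OF X_in[OF h i'] Y_in, symmetric] .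
        qed (use fin \<epsilon> in auto)
        also have "family_norm (J \<times> I') (\<lambda>q. X h q - Y q) \<le> \<epsilon> * n"
          unfolding n_def using fin \<epsilon> L0(3)[OF KL(4-6) slice[OF h]]
          by (intro family_norm_slices_le') (auto simp: X_def Y_def)
        finally have "family_norm (I \<times> I') (\<lambda>p. FX p - FY p) \<le> (1 + \<epsilon>) * (\<epsilon> * n)"
          using \<epsilon> by (simp add: mult_left_mono)
        also have "\<dots> \<le> 2 * (\<epsilon> * n)"
          using \<epsilon> n by (intro mult_right_mono) auto
        finally show ?thesis by simp
      qed
      have 3: "family_norm (I \<times> I') (\<lambda>p. FY p - P p) \<le> N * \<epsilon> * n"
      proof -
        \<comment> \<open>The exponent pairs that occur in \<open>P\<close>. Those left after
          removing the rectangle avoid \<open>Z0\<close>, so their total weight is at most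
          \<epsilon>.\<close>
        define Z where "Z = (\<Union>k\<in>K. index_splits d k)"
        have Z: "finite Z" "Z \<subseteq> M \<times> M" "K1 \<times> L1 \<subseteq> Z"
          using K KL finite_index_splits by (auto simp: Z_def M_def index_splits_def image_subset_iff subset_iff)
        have "hnorm (FY p - P p) \<le> \<epsilon> * n" if p: "p \<in> I \<times> I'" for p
        proof -
          let ?t = "kronecker_term J J' c c' h p"
          have t_in: "?t z \<in> H" for z
            using h by (cases z) (auto simp: kronecker_term_def family_space_def intro!: sum_in_H scale_in_H mon_in_H)
          have "FY p = sum ?t (K1 \<times> L1)"
            using partial_partial[OF h] by (cases p) (simp add: FY_def Y_def)
          moreover have "P p = sum ?t Z"
            unfolding P_def Z_def using partial_kronecker_coeff[OF K(1) h] .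
          moreover have "sum ?t Z = sum ?t (Z - K1 \<times> L1) + sum ?t (K1 \<times> L1)"
            by (rule sum.subset_diff[OF Z(3,1)])
          ultimately have "FY p - P p = scale (-1) (sum ?t (Z - K1 \<times> L1))"
            by simp
          then have "hnorm (FY p - P p) = hnorm (sum ?t (Z - K1 \<times> L1))"
            using t_in by (simp only: hnorm_scale sum_in_H) simp
          also have "\<dots> \<le> (\<Sum>z\<in>Z - K1 \<times> L1. hnorm (?t z))"
            using t_in by (rule hnorm_sum_le)
          also have "\<dots> \<le> (\<Sum>(a, b)\<in>Z - K1 \<times> L1. u a * v b * n)"
            using hnorm_kronecker_term_le[OF r(1,3) fin(1,2,3,4) p h]
            by (intro sum_mono) (auto simp: u_def v_def n_def)
          also have "\<dots> = (\<Sum>(a, b)\<in>Z - K1 \<times> L1. u a * v b) * n"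
            by (simp add: sum_distrib_right case_prod_unfold)
          also have "\<dots> \<le> \<epsilon> * n"
            using Z KL n by (intro mult_right_mono tail) auto
          finally show ?thesis .
        qed
        then have "(\<Sum>p\<in>I \<times> I'. hnorm (FY p - P p)) \<le> N * (\<epsilon> * n)"
          unfolding N_def by (rule sum_bounded_above)
        moreover have "family_norm (I \<times> I') (\<lambda>p. FY p - P p) \<le> (\<Sum>p\<in>I \<times> I'. hnorm (FY p - P p))"
          unfolding family_norm_L2 using spaces
          by (intro L2_set_le_sum) (auto simp: family_space_def diff_in_H)
        ultimately show ?thesis by simp
      qed
      have "family_norm (I \<times> I') (\<lambda>p. E h p - P p) =
          family_norm (I \<times> I') (\<lambda>p. (E h p - FX p) + ((FX p - FY p) + (FY p - P p)))"
        by simp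
      also have "\<dots> \<le> family_norm (I \<times> I') (\<lambda>p. E h p - FX p) +
          (family_norm (I \<times> I') (\<lambda>p. FX p - FY p) + family_norm (I \<times> I') (\<lambda>p. FY p - P p))"
        using spaces
        by (intro order_trans[OF family_norm_triangle] add_left_mono family_norm_triangle)
           (auto simp: family_space_def diff_in_H add_in_H)
      also have "\<dots> \<le> \<epsilon> * (3 + N) * n"
        using 1 2 3 by (simp add: algebra_simps)
      also have "\<dots> \<le> e * n"
        using \<epsilon> n by (intro mult_right_mono)
      finally show "family_norm (I \<times> I') (\<lambda>i. E h i - partial (J \<times> J') (kronecker_coeff d c c') K h i)
          \<le> e * family_norm (J \<times> J') h"
        by (simp add: P_def n_def)
    qed
  qed
qed

end

section \<open>Introduction rules and closure properties of the Schur-Agler class\<close>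

lemma schur_aglerI:
  fixes f :: "(nat \<Rightarrow> complex) \<Rightarrow> 'i \<Rightarrow> 'j \<Rightarrow> complex"
  assumes "has_power_series d J I f c"
    and "\<And>(scale :: complex \<Rightarrow> 'h::ab_group_add \<Rightarrow> 'h) H ip T. contraction_tuple scale H ip d T \<Longrightarrow>
      \<exists>F. chilbert_space.has_operator_value scale H ip d J I c T F \<and>
          (\<forall>h \<in> chilbert_space.family_space H J.
             chilbert_space.family_norm ip I (F h) \<le> chilbert_space.family_norm ip J h)"
  shows "f \<in> schur_agler TYPE('h) d J I"
  using assms unfolding schur_agler_def contraction_tuple_def contraction_tuple_axioms_def by blast

lemma schur_aglerE:
  fixes f :: "(nat \<Rightarrow> complex) \<Rightarrow> 'i \<Rightarrow> 'j \<Rightarrow> complex"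
  assumes "f \<in> schur_agler TYPE('h::ab_group_add) d J I"
  obtains c where "has_power_series d J I f c"
    "\<And>(scale :: complex \<Rightarrow> 'h \<Rightarrow> 'h) H ip T. contraction_tuple scale H ip d T \<Longrightarrow>
      \<exists>F. chilbert_space.has_operator_value scale H ip d J I c T F \<and>
          (\<forall>h \<in> chilbert_space.family_space H J.
             chilbert_space.family_norm ip I (F h) \<le> chilbert_space.family_norm ip J h)"
  using assms unfolding schur_agler_def contraction_tuple_def contraction_tuple_axioms_def by blast

lemma schur_agler_cong:
  assumes "f \<in> schur_agler TYPE('h::ab_group_add) d J I"
    and "\<And>z i j. i \<in> I \<Longrightarrow> j \<in> J \<Longrightarrow> g z i j = f z i j"
  shows "g \<in> schur_agler TYPE('h) d J I"
  using assms(1)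
proof (rule schur_aglerE)
  fix c assume "has_power_series d J I f c"
  then have "has_power_series d J I g c"
    using assms(2) by (simp add: has_power_series_def)
  then show ?thesis if "\<And>(scale :: complex \<Rightarrow> 'h \<Rightarrow> 'h) H ip T. contraction_tuple scale H ip d T \<Longrightarrow>
      \<exists>F. chilbert_space.has_operator_value scale H ip d J I c T F \<and>
          (\<forall>h \<in> chilbert_space.family_space H J.
             chilbert_space.family_norm ip I (F h) \<le> chilbert_space.family_norm ip J h)"
    using that by (rule schur_aglerI)
qed

lemma schur_agler_kronecker:
  assumes fin: "finite I" "finite J" "finite I'" "finite J'"
    and f: "f \<in> schur_agler TYPE('h::ab_group_add) d J I"
    and g: "g \<in> schur_agler TYPE('h) d J' I'"
  shows "(\<lambda>z. kronecker (f z) (g z)) \<in> schur_agler TYPE('h) d (J \<times> J') (I \<times> I')"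
proof (rule schur_aglerE[OF f], rule schur_aglerE[OF g])
  fix c c'
  assume c: "has_power_series d J I f c" and c': "has_power_series d J' I' g c'"
  assume F: "\<And>(scale :: complex \<Rightarrow> 'h \<Rightarrow> 'h) H ip T. contraction_tuple scale H ip d T \<Longrightarrow>
      \<exists>F. chilbert_space.has_operator_value scale H ip d J I c T F \<and>
          (\<forall>h \<in> chilbert_space.family_space H J.
             chilbert_space.family_norm ip I (F h) \<le> chilbert_space.family_norm ip J h)"
  assume G: "\<And>(scale :: complex \<Rightarrow> 'h \<Rightarrow> 'h) H ip T. contraction_tuple scale H ip d T \<Longrightarrow>
      \<exists>F. chilbert_space.has_operator_value scale H ip d J' I' c' T F \<and>
          (\<forall>h \<in> chilbert_space.family_space H J'.
             chilbert_space.family_norm ip I' (F h) \<le> chilbert_space.family_norm ip J' h)"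
  show ?thesis
  proof (rule schur_aglerI[OF has_power_series_kronecker[OF c c']])
    fix scale :: "complex \<Rightarrow> 'h \<Rightarrow> 'h" and H ip T
    assume T: "contraction_tuple scale H ip d T"
    then interpret contraction_tuple scale H ip d T .
    obtain A B where "has_operator_value d J I c T A"
        "\<And>h. h \<in> family_space J \<Longrightarrow> family_norm I (A h) \<le> family_norm J h"
      and "has_operator_value d J' I' c' T B"
        "\<And>h. h \<in> family_space J' \<Longrightarrow> family_norm I' (B h) \<le> family_norm J' h"
      using F[OF T] G[OF T] by blast
    from has_operator_value_kronecker[OF fin c c' this]
    show "\<exists>F. has_operator_value d (J \<times> J') (I \<times> I') (kronecker_coeff d c c') T F \<and>
        (\<forall>h\<in>family_space (J \<times> J'). family_norm (I \<times> I') (F h) \<le> family_norm (J \<times> J') h)"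
      by blast
  qed
qed

section \<open>Averaged reindexing\<close>

text \<open>This is \<open>V* A W\<close>, where \<open>W\<close> sends the basis vector
  \<open>e_j\<close> to the sum of the \<open>e_(\<pi> s j)\<close> over \<open>s\<close> in
  \<open>G\<close>, divided by \<open>sqrt (card G)\<close>, and \<open>V\<close> is built from
  \<rho> in the same way. The two normalisations combine into \<open>1 / card G\<close>.\<close>

definition average ::
  "'g set \<Rightarrow> ('g \<Rightarrow> 'a \<Rightarrow> 'i) \<Rightarrow> ('g \<Rightarrow> 'b \<Rightarrow> 'j) \<Rightarrow> ('i \<Rightarrow> 'j \<Rightarrow> complex) \<Rightarrow> 'a \<Rightarrow> 'b \<Rightarrow> complex" where
  "average G \<rho> \<pi> A i j = (\<Sum>t\<in>G. \<Sum>s\<in>G. A (\<rho> t i) (\<pi> s j)) / of_nat (card G)"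

lemma has_power_series_average:
  assumes "has_power_series d J I f c"
    and "\<And>t i. t \<in> G \<Longrightarrow> i \<in> I' \<Longrightarrow> \<rho> t i \<in> I" "\<And>s j. s \<in> G \<Longrightarrow> j \<in> J' \<Longrightarrow> \<pi> s j \<in> J"
  shows "has_power_series d J' I' (\<lambda>z. average G \<rho> \<pi> (f z)) (\<lambda>k. average G \<rho> \<pi> (c k))"
  unfolding has_power_series_def
proof (intro ballI)
  fix z i j assume z: "z \<in> polydisc d" "i \<in> I'" "j \<in> J'"
  have "((\<lambda>k. (\<Sum>t\<in>G. \<Sum>s\<in>G. c k (\<rho> t i) (\<pi> s j) * (\<Prod>l<d. z l ^ k l)) * (1 / of_nat (card G)))
      has_sum (\<Sum>t\<in>G. \<Sum>s\<in>G. f z (\<rho> t i) (\<pi> s j)) * (1 / of_nat (card G))) (multi_indices d)"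
    using assms z by (intro has_sum_cmult_left has_sum_finite_sum) (auto simp: has_power_series_def)
  then show "((\<lambda>k. average G \<rho> \<pi> (c k) i j * (\<Prod>l<d. z l ^ k l)) has_sum average G \<rho> \<pi> (f z) i j)
      (multi_indices d)"
    by (simp add: average_def sum_distrib_right sum_divide_distrib)
qed

context chilbert_space
begin

text \<open>The operator \<open>W\<close> without its normalisation: \<open>h j\<close> is copied to
  every index \<open>\<pi> s j\<close>. The choice made by \<open>inv_into\<close> is unambiguous
  when \<pi> is injective on pairs.\<close>

definition lift_family :: "'g set \<Rightarrow> 'b set \<Rightarrow> ('g \<Rightarrow> 'b \<Rightarrow> 'j) \<Rightarrow> ('b \<Rightarrow> 'h) \<Rightarrow> 'j \<Rightarrow> 'h" where
  "lift_family G J' \<pi> h x =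
     (if x \<in> case_prod \<pi> ` (G \<times> J') then h (snd (inv_into (G \<times> J') (case_prod \<pi>) x)) else 0)"

text \<open>The adjoint \<open>V*\<close>, carrying also the normalisation left out of
  \<open>lift_family\<close>.\<close>

definition average_family :: "'g set \<Rightarrow> ('g \<Rightarrow> 'a \<Rightarrow> 'i) \<Rightarrow> ('i \<Rightarrow> 'h) \<Rightarrow> 'a \<Rightarrow> 'h" where
  "average_family G \<rho> y i = scale (1 / of_nat (card G)) (\<Sum>t\<in>G. y (\<rho> t i))"

lemma lift_family_in: "h \<in> family_space J' \<Longrightarrow> lift_family G J' \<pi> h \<in> family_space J"
proof -
  assume h: "h \<in> family_space J'"
  have "lift_family G J' \<pi> h x \<in> H" for x
  proof (cases "x \<in> case_prod \<pi> ` (G \<times> J')")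
    case True
    from inv_into_into[OF this] have "snd (inv_into (G \<times> J') (case_prod \<pi>) x) \<in> J'"
      by (rule SigmaE) simp
    with True h show ?thesis
      unfolding lift_family_def family_space_def by simp
  qed (simp add: lift_family_def)
  then show ?thesis
    by (simp add: family_space_def)
qed

text \<open>A general \<phi> that vanishes at the zero vector serves two purposes: squared norms,
  and the action of a matrix.\<close>

lemma sum_lift_family:
  assumes "finite J" "inj_on (case_prod \<pi>) (G \<times> J')" "case_prod \<pi> ` (G \<times> J') \<subseteq> J"
    and "\<And>x. \<phi> x 0 = 0"
  shows "(\<Sum>x\<in>J. \<phi> x (lift_family G J' \<pi> h x)) = (\<Sum>s\<in>G. \<Sum>j\<in>J'. \<phi> (\<pi> s j) (h j))"
proof -
  have "(\<Sum>x\<in>J. \<phi> x (lift_family G J' \<pi> h x)) =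
        (\<Sum>x\<in>case_prod \<pi> ` (G \<times> J'). \<phi> x (lift_family G J' \<pi> h x))"
    using assms by (intro sum.mono_neutral_right) (auto simp: lift_family_def)
  also have "\<dots> = (\<Sum>(s, j)\<in>G \<times> J'. \<phi> (\<pi> s j) (lift_family G J' \<pi> h (\<pi> s j)))"
    using assms(2) by (subst sum.reindex) (auto simp: case_prod_unfold)
  also have "\<dots> = (\<Sum>(s, j)\<in>G \<times> J'. \<phi> (\<pi> s j) (h j))"
  proof (intro sum.cong refl, clarify)
    fix s j assume "s \<in> G" "j \<in> J'"
    then have sj: "(s, j) \<in> G \<times> J'" by simp
    have "lift_family G J' \<pi> h (case_prod \<pi> (s, j)) = h j"
      unfolding lift_family_def inv_into_f_f[OF assms(2) sj] if_P[OF imageI[OF sj]] by simp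
    then show "\<phi> (\<pi> s j) (lift_family G J' \<pi> h (\<pi> s j)) = \<phi> (\<pi> s j) (h j)" by simp
  qed
  finally show ?thesis by (simp add: sum.cartesian_product)
qed

lemma family_norm_lift:
  assumes "finite J" "inj_on (case_prod \<pi>) (G \<times> J')" "case_prod \<pi> ` (G \<times> J') \<subseteq> J"
  shows "family_norm J (lift_family G J' \<pi> h) = sqrt (card G) * family_norm J' h"
  unfolding family_norm_def
  using sum_lift_family[OF assms, of "\<lambda>_ v. (hnorm v)\<^sup>2" h] by (simp add: real_sqrt_mult)

lemma average_family_in:
  assumes "y \<in> family_space I" "\<And>t i. t \<in> G \<Longrightarrow> i \<in> I' \<Longrightarrow> \<rho> t i \<in> I"
  shows "average_family G \<rho> y \<in> family_space I'"
  using assms by (auto simp: family_space_def average_family_def intro!: scale_in_H sum_in_H)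

text \<open>Cauchy-Schwarz for the mean over \<open>G\<close>; by injectivity every entry of
  \<open>y\<close> is used at most once.\<close>

lemma family_norm_average:
  assumes fin: "finite I" "finite G" and G: "G \<noteq> {}"
    and inj: "inj_on (case_prod \<rho>) (G \<times> I')" and im: "case_prod \<rho> ` (G \<times> I') \<subseteq> I"
    and y: "y \<in> family_space I"
  shows "sqrt (card G) * family_norm I' (average_family G \<rho> y) \<le> family_norm I y"
proof (rule power2_le_imp_le)
  define N where "N = real (card G)"
  have N: "N > 0" using fin G by (simp add: N_def card_gt_0_iff)
  have y_in: "y (\<rho> t i) \<in> H" if "t \<in> G" "i \<in> I'" for t i
    using y im that by (auto simp: family_space_def)
  have "N * (hnorm (average_family G \<rho> y i))\<^sup>2 \<le> (\<Sum>t\<in>G. (hnorm (y (\<rho> t i)))\<^sup>2)" if i: "i \<in> I'" for i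
  proof -
    have "hnorm (average_family G \<rho> y i) = 1 / N * hnorm (\<Sum>t\<in>G. y (\<rho> t i))"
      unfolding average_family_def using y_in[OF _ i]
      by (subst hnorm_scale) (auto intro: sum_in_H simp: N_def norm_divide)
    also have "\<dots> \<le> 1 / N * (\<Sum>t\<in>G. hnorm (y (\<rho> t i)))"
      using y_in[OF _ i] N by (intro mult_left_mono hnorm_sum_le) auto
    finally have "(hnorm (average_family G \<rho> y i))\<^sup>2 \<le> (1 / N * (\<Sum>t\<in>G. hnorm (y (\<rho> t i))))\<^sup>2"
      using y_in[OF _ i] unfolding average_family_def
      by (intro power_mono hnorm_nonneg scale_in_H sum_in_H)
    also have "\<dots> \<le> (1 / N)\<^sup>2 * (N * (\<Sum>t\<in>G. (hnorm (y (\<rho> t i)))\<^sup>2))"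
      unfolding power_mult_distrib N_def
      using sum_squared_le_sum_of_squares[of "\<lambda>t. hnorm (y (\<rho> t i))" G]
      by (intro mult_left_mono) (simp_all add: mult.commute)
    finally show ?thesis
      using N by (simp add: power2_eq_square field_simps)
  qed
  then have "(\<Sum>i\<in>I'. N * (hnorm (average_family G \<rho> y i))\<^sup>2) \<le> (\<Sum>i\<in>I'. \<Sum>t\<in>G. (hnorm (y (\<rho> t i)))\<^sup>2)"
    by (rule sum_mono)
  also have "\<dots> = (\<Sum>x\<in>case_prod \<rho> ` (G \<times> I'). (hnorm (y x))\<^sup>2)"
    using inj by (subst sum.swap, subst sum.reindex) (auto simp: sum.cartesian_product case_prod_unfold)
  also have "\<dots> \<le> (\<Sum>x\<in>I. (hnorm (y x))\<^sup>2)"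
    using fin im by (intro sum_mono2) auto
  finally show "(sqrt (card G) * family_norm I' (average_family G \<rho> y))\<^sup>2 \<le> (family_norm I y)\<^sup>2"
    by (simp add: power_mult_distrib family_norm_power2 sum_distrib_left N_def)
qed simp

end

context contraction_tuple
begin

text \<open>An exact identity for each finite partial sum: lifting and averaging act on the matrix
  indices, monomials act on \<open>H\<close>. No new limit has to be taken.\<close>

lemma partial_average:
  assumes "finite J" "inj_on (case_prod \<pi>) (G \<times> J')" "case_prod \<pi> ` (G \<times> J') \<subseteq> J"
  shows "partial J' (\<lambda>k. average G \<rho> \<pi> (c k)) K h i =
         average_family G \<rho> (partial J c K (lift_family G J' \<pi> h)) i"
proof -
  let ?s = "\<lambda>t s j k. scale (c k (\<rho> t i) (\<pi> s j)) (mon k (h j))"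
  have lift: "matrix_tensor J (c k) (mon k) (lift_family G J' \<pi> h) (\<rho> t i) =
      (\<Sum>s\<in>G. \<Sum>j\<in>J'. ?s t s j k)" for k t
    unfolding matrix_tensor_def
    by (rule sum_lift_family[OF assms, where \<phi> = "\<lambda>x v. scale (c k (\<rho> t i) x) (mon k v)"])
       (simp add: linear_on_H_zero[OF linear_mon])
  have "partial J' (\<lambda>k. average G \<rho> \<pi> (c k)) K h i =
      (\<Sum>k\<in>K. \<Sum>j\<in>J'. scale (1 / of_nat (card G)) (\<Sum>t\<in>G. \<Sum>s\<in>G. ?s t s j k))"
    by (simp add: partial_value_def matrix_tensor_def average_def divide_inverse mult.commute
        scale_scale[symmetric] scale_sum_left[symmetric] del: scale_scale)
  also have "\<dots> = scale (1 / of_nat (card G)) (\<Sum>k\<in>K. \<Sum>j\<in>J'. \<Sum>t\<in>G. \<Sum>s\<in>G. ?s t s j k)"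
    by (simp only: scale_sum_right)
  also have "(\<Sum>k\<in>K. \<Sum>j\<in>J'. \<Sum>t\<in>G. \<Sum>s\<in>G. ?s t s j k) = (\<Sum>k\<in>K. \<Sum>t\<in>G. \<Sum>s\<in>G. \<Sum>j\<in>J'. ?s t s j k)"
    by (intro sum.cong refl, subst sum.swap, intro sum.cong refl sum.swap)
  also have "\<dots> = (\<Sum>t\<in>G. \<Sum>k\<in>K. \<Sum>s\<in>G. \<Sum>j\<in>J'. ?s t s j k)"
    by (rule sum.swap)
  finally show ?thesis
    by (simp add: average_family_def partial_value_def lift)
qed

lemma mon_zero: "(\<And>l. l < d \<Longrightarrow> k l = 0) \<Longrightarrow> mon k x = x"
proof -
  assume k: "\<And>l. l < d \<Longrightarrow> k l = 0"
  have "mon_list k ls = id" if "set ls \<subseteq> {..<d}" for ls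
    using that by (induction ls) (auto simp: mon_list_Nil mon_list_Cons k)
  from this[of "[0..<d]"] show ?thesis
    by (simp add: monomial_op_eq atLeast0LessThan)
qed

end

text \<open>Lifting multiplies the norm by \<open>sqrt (card G)\<close> and averaging takes this
  factor back, so bounds pass from \<open>f\<close> to the average unchanged.\<close>

lemma schur_agler_average:
  fixes \<rho> :: "'g \<Rightarrow> 'a \<Rightarrow> 'i" and \<pi> :: "'g \<Rightarrow> 'b \<Rightarrow> 'j"
  assumes fin: "finite I" "finite J" "finite G" and G: "G \<noteq> {}"
    and \<rho>: "inj_on (case_prod \<rho>) (G \<times> I')" "case_prod \<rho> ` (G \<times> I') \<subseteq> I"
    and \<pi>: "inj_on (case_prod \<pi>) (G \<times> J')" "case_prod \<pi> ` (G \<times> J') \<subseteq> J"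
    and f: "f \<in> schur_agler TYPE('h::ab_group_add) d J I"
  shows "(\<lambda>z. average G \<rho> \<pi> (f z)) \<in> schur_agler TYPE('h) d J' I'"
  using f
proof (rule schur_aglerE)
  fix c assume c: "has_power_series d J I f c"
  assume F: "\<And>(scale :: complex \<Rightarrow> 'h \<Rightarrow> 'h) H ip T. contraction_tuple scale H ip d T \<Longrightarrow>
      \<exists>F. chilbert_space.has_operator_value scale H ip d J I c T F \<and>
          (\<forall>h \<in> chilbert_space.family_space H J.
             chilbert_space.family_norm ip I (F h) \<le> chilbert_space.family_norm ip J h)"
  have \<rho>_in: "\<rho> t i \<in> I" if "t \<in> G" "i \<in> I'" for t i using \<rho>(2) that by auto
  have \<pi>_in: "\<pi> t j \<in> J" if "t \<in> G" "j \<in> J'" for t j using \<pi>(2) that by auto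
  show ?thesis
  proof (rule schur_aglerI[OF has_power_series_average[OF c]])
    fix scale :: "complex \<Rightarrow> 'h \<Rightarrow> 'h" and H ip T
    assume T: "contraction_tuple scale H ip d T"
    then interpret contraction_tuple scale H ip d T .
    obtain A where A: "has_operator_value d J I c T A"
        "\<And>h. h \<in> family_space J \<Longrightarrow> family_norm I (A h) \<le> family_norm J h"
      using F[OF T] by blast
    let ?N = "sqrt (card G)"
    have N: "?N > 0" using fin G by (simp add: card_gt_0_iff)
    define L where "L = lift_family G J' \<pi>"
    have L: "L h \<in> family_space J" "family_norm J (L h) = ?N * family_norm J' h"
      if "h \<in> family_space J'" for h
      using that family_norm_lift[OF fin(2) \<pi>] by (auto simp: L_def lift_family_in)
    define F where "F h = average_family G \<rho> (A (L h))" for h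
    have A_in: "A (L h) \<in> family_space I" if "h \<in> family_space J'" for h
      using A(1) L(1)[OF that] by (simp add: has_operator_value_def)
    \<comment> \<open>Used twice: with \<open>e = 1\<close> for contractivity, and on the truncation
      error, where it shows that the set \<open>K0\<close> found for \<open>f\<close> still
      works.\<close>
    have bound: "family_norm I' (average_family G \<rho> y) \<le> e * family_norm J' h"
      if "y \<in> family_space I" "h \<in> family_space J'" "family_norm I y \<le> e * family_norm J (L h)" for y h e
    proof -
      have "?N * family_norm I' (average_family G \<rho> y) \<le> ?N * (e * family_norm J' h)"
        using family_norm_average[OF fin(1,3) G \<rho> that(1)] that(3) L(2)[OF that(2)] by (simp add: mult_ac)
      then show ?thesis using N by simp
    qed
    show "\<exists>F. has_operator_value d J' I' (\<lambda>k. average G \<rho> \<pi> (c k)) T F \<and>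
        (\<forall>h\<in>family_space J'. family_norm I' (F h) \<le> family_norm J' h)"
    proof (intro exI[of _ F] conjI ballI)
      fix h assume h: "h \<in> family_space J'"
      show "family_norm I' (F h) \<le> family_norm J' h"
        using bound[OF A_in[OF h] h, of 1] A(2)[OF L(1)[OF h]] by (simp add: F_def)
    next
      show "has_operator_value d J' I' (\<lambda>k. average G \<rho> \<pi> (c k)) T F"
        unfolding has_operator_value_iff
      proof (intro conjI allI impI ballI)
        fix h assume "h \<in> family_space J'"
        then show "F h \<in> family_space I'"
          unfolding F_def using A_in \<rho>_in by (intro average_family_in[of _ I])
      next
        fix e :: real assume "e > 0"
        obtain K0 where K0: "finite K0" "K0 \<subseteq> multi_indices d"
          "\<And>K h. finite K \<Longrightarrow> K0 \<subseteq> K \<Longrightarrow> K \<subseteq> multi_indices d \<Longrightarrow> h \<in> family_space J \<Longrightarrow>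
             family_norm I (\<lambda>i. A h i - partial J c K h i) \<le> e * family_norm J h"
          by (rule has_operator_valueE[OF A(1) \<open>e > 0\<close>]) blast
        have "family_norm I' (\<lambda>i. F h i - partial J' (\<lambda>k. average G \<rho> \<pi> (c k)) K h i) \<le> e * family_norm J' h"
          if K: "finite K" "K0 \<subseteq> K" "K \<subseteq> multi_indices d" and h: "h \<in> family_space J'" for K h
        proof -
          let ?y = "\<lambda>i. A (L h) i - partial J c K (L h) i"
          have "?y \<in> family_space I"
            using A_in[OF h] L(1)[OF h] by (auto simp: family_space_def intro!: diff_in_H partial_in_H)
          then have "family_norm I' (average_family G \<rho> ?y) \<le> e * family_norm J' h"
            using h K0(3)[OF K L(1)[OF h]] by (rule bound)
          also have "average_family G \<rho> ?y =
              (\<lambda>i. F h i - partial J' (\<lambda>k. average G \<rho> \<pi> (c k)) K h i)"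
            by (rule ext) (simp add: partial_average[OF fin(2) \<pi>] F_def L_def average_family_def sum_subtractf
                scale_right_diff_distrib)
          finally show ?thesis .
        qed
        then show "\<exists>K0. finite K0 \<and> K0 \<subseteq> multi_indices d \<and>
            (\<forall>K. finite K \<and> K0 \<subseteq> K \<and> K \<subseteq> multi_indices d \<longrightarrow>
             (\<forall>h\<in>family_space J'.
               family_norm I' (\<lambda>i. F h i - partial J' (\<lambda>k. average G \<rho> \<pi> (c k)) K h i)
                 \<le> e * family_norm J' h))"
          using K0(1,2) by blast
      qed
    qed
  qed (fact \<rho>_in \<pi>_in)+
qed

text \<open>Averaging over a one-element set: passage to a relabelled submatrix.\<close>

lemma schur_agler_reindex:
  assumes "finite I" "finite J" "inj_on \<rho> I'" "\<rho> ` I' \<subseteq> I" "inj_on \<pi> J'" "\<pi> ` J' \<subseteq> J"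
    and "f \<in> schur_agler TYPE('h::ab_group_add) d J I"
  shows "(\<lambda>z i j. f z (\<rho> i) (\<pi> j)) \<in> schur_agler TYPE('h) d J' I'"
proof -
  have "(\<lambda>z. average {()} (\<lambda>_. \<rho>) (\<lambda>_. \<pi>) (f z)) \<in> schur_agler TYPE('h) d J' I'"
    using assms(3,5)
    by (intro schur_agler_average[OF assms(1,2) _ _ _ _ _ _ assms(7)])
       (use assms(4,6) in \<open>auto simp: inj_on_def\<close>)
  then show ?thesis
    by (rule schur_agler_cong) (simp add: average_def)
qed

text \<open>The empty tensor power, where the induction on \<open>k\<close> starts.\<close>

lemma schur_agler_one:
  "(\<lambda>_ _ _. 1) \<in> schur_agler TYPE('h::ab_group_add) d {j} {i}"
proof -
  define k0 where "k0 = (\<lambda>l\<in>{..<d}. 0::nat)"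
  have k0: "k0 \<in> multi_indices d" by (simp add: k0_def multi_indices_def)
  define c :: "(nat \<Rightarrow> nat) \<Rightarrow> 'a \<Rightarrow> 'b \<Rightarrow> complex" where "c k p q = (if k = k0 then 1 else 0)" for k p q
  show ?thesis
  proof (rule schur_aglerI)
    show "has_power_series d {j} {i} (\<lambda>_ _ _. 1) c"
      unfolding has_power_series_def
    proof (intro ballI)
      fix z i' j'
      have "((\<lambda>k. c k i' j' * (\<Prod>l<d. z l ^ k l)) has_sum 1) {k0}"
        by (rule has_sum_finiteI) (auto simp: c_def k0_def)
      then show "((\<lambda>k. c k i' j' * (\<Prod>l<d. z l ^ k l)) has_sum 1) (multi_indices d)"
        by (rule has_sum_cong_neutral[THEN iffD1, rotated -1]) (use k0 in \<open>auto simp: c_def\<close>)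
    qed
  next
    fix scale :: "complex \<Rightarrow> 'h \<Rightarrow> 'h" and H ip T
    assume "contraction_tuple scale H ip d T"
    then interpret contraction_tuple scale H ip d T .
    have P: "partial {j} c K h i = h j" if "finite K" "k0 \<in> K" for K h
    proof -
      have "partial {j} c K h i = (\<Sum>k\<in>K. if k = k0 then h j else 0)"
        unfolding partial_value_def matrix_tensor_def
        by (intro sum.cong) (auto simp: c_def mon_zero k0_def)
      with that show ?thesis by simp
    qed
    have "has_operator_value d {j} {i} c T (\<lambda>h _. h j)"
      unfolding has_operator_value_iff
      using P k0 by (auto simp: family_space_def family_norm_def intro!: exI[of _ "{k0}"])
    then show "\<exists>F. has_operator_value d {j} {i} c T F \<and>
        (\<forall>h\<in>family_space {j}. family_norm {i} (F h) \<le> family_norm {j} h)"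
      by (auto simp: family_norm_def)
  qed
qed

section \<open>Tensor powers and permanental compounds\<close>

text \<open>Indexing by lists keeps one index type for all \<open>k\<close>, whereas iterated pairs
  would change type at each step and block the induction. Head and tail translate between lists of
  length \<open>Suc k\<close> and the pairs of \<open>schur_agler_kronecker\<close>.\<close>

lemma schur_agler_tensor_power:
  assumes "finite I" "S \<in> schur_agler TYPE('h::ab_group_add) d I I"
  defines "W \<equiv> \<lambda>k. {is. set is \<subseteq> I \<and> length is = k}"
  shows "(\<lambda>z is js. \<Prod>a<k. S z (is ! a) (js ! a)) \<in> schur_agler TYPE('h) d (W k) (W k)"
proof (induction k)
  case 0
  have "W 0 = {[]}" by (auto simp: W_def)
  with schur_agler_one show ?case by simp
next
  case (Suc k)
  have fin: "finite (W k)" for k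
    unfolding W_def using assms(1) by (rule finite_lists_length_eq)
  let ?u = "\<lambda>xs. (hd xs, tl xs)"
  have Cons: "\<exists>x ys. xs = x # ys \<and> x \<in> I \<and> ys \<in> W k" if "xs \<in> W (Suc k)" for xs
    using that by (cases xs) (auto simp: W_def)
  have u: "inj_on ?u (W (Suc k))" "?u ` W (Suc k) \<subseteq> I \<times> W k"
    by (auto intro!: inj_onI dest!: Cons)
  have "(\<lambda>z is js. kronecker (S z) (\<lambda>is js. \<Prod>a<k. S z (is ! a) (js ! a)) (?u is) (?u js))
      \<in> schur_agler TYPE('h) d (W (Suc k)) (W (Suc k))"
    using schur_agler_kronecker[OF assms(1,1) fin fin assms(2) Suc.IH] fin assms(1)
    by (intro schur_agler_reindex[OF _ _ u u]) auto
  then show ?case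
    by (rule schur_agler_cong)
       (auto dest!: Cons simp: kronecker_def prod.lessThan_Suc_shift simp del: prod.lessThan_Suc)
qed

text \<open>Substituting \<open>s \<circ> t\<close> for \<open>s\<close> and then reindexing the
  product by \<open>t\<close> removes \<open>t\<close> from the inner sum. Each of the
  \<open>k!\<close> row permutations thus contributes the same permanent.\<close>

lemma average_permutations_eq_permanental_compound:
  assumes "length is = k" "length js = k"
  shows "average {p. p permutes {..<k}} permute_list permute_list (\<lambda>is js. \<Prod>a<k. A (is ! a) (js ! a)) is js =
         permanental_compound k A is js"
proof -
  let ?P = "{p. p permutes {..<k}}"
  have "(\<Sum>s\<in>?P. \<Prod>a<k. A (permute_list t is ! a) (permute_list s js ! a)) =
        permanental_compound k A is js" if t: "t \<in> ?P" for t
  proof -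
    have t: "t permutes {..<k}" using t by simp
    have "(\<Sum>s\<in>?P. \<Prod>a<k. A (permute_list t is ! a) (permute_list s js ! a)) =
          (\<Sum>s\<in>?P. \<Prod>a<k. A (is ! t a) (js ! s a))"
      by (intro sum.cong prod.cong refl) (use assms t in \<open>simp add: permute_list_nth\<close>)
    also have "\<dots> = (\<Sum>s\<in>?P. \<Prod>a<k. A (is ! t a) (js ! (s \<circ> t) a))"
      using sum_permutations_compose_right[OF t, of "\<lambda>s. \<Prod>a<k. A (is ! t a) (js ! s a)"] by simp
    also have "\<dots> = (\<Sum>s\<in>?P. \<Prod>a<k. A (is ! a) (js ! s a))"
      using prod.reindex_bij_betw[OF permutes_imp_bij[OF t]] by (intro sum.cong) simp_all
    finally show ?thesis
      by (simp add: permanental_compound_def permanent_def)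
  qed
  then have "(\<Sum>t\<in>?P. \<Sum>s\<in>?P. \<Prod>a<k. A (permute_list t is ! a) (permute_list s js ! a)) =
      of_nat (card ?P) * permanental_compound k A is js"
    by simp
  moreover have "card ?P \<noteq> 0"
    by (simp add: card_permutations)
  ultimately show ?thesis
    by (simp add: average_def)
qed

text \<open>The orthogonality of the symmetrised vectors. Permuting a list keeps its set, which
  determines an increasing list; as its entries are distinct, the permutation can be read off as
  well. Repeated entries would destroy the second half.\<close>

lemma inj_permute_list_increasing_seqs:
  "inj_on (case_prod permute_list) ({p. p permutes {..<k}} \<times> increasing_seqs n k)"
proof (rule inj_onI, clarify)
  fix s t js js'
  assume s: "s permutes {..<k}" and t: "t permutes {..<k}"
    and js: "js \<in> increasing_seqs n k" and js': "js' \<in> increasing_seqs n k"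
    and eq: "permute_list s js = permute_list t js'"
  have len: "length js = k" "length js' = k"
    using js js' by (auto simp: increasing_seqs_def)
  have "set js = set js'"
    using arg_cong[OF eq, of set] s t len by simp
  then have "js = js'"
    using js js' by (intro strict_sorted_equal) (auto simp: increasing_seqs_def)
  have "s a = t a" for a
  proof (cases "a < k")
    case True
    then have "js ! s a = js ! t a"
      using arg_cong[OF eq, of "\<lambda>xs. xs ! a"] s t len \<open>js = js'\<close> by (simp add: permute_list_nth)
    moreover have "distinct js"
      using js by (simp add: increasing_seqs_def strict_sorted_iff)
    moreover have "s a < k" "t a < k"
      using True permutes_in_image[OF s, of a] permutes_in_image[OF t, of a] by auto
    ultimately show ?thesis
      using len by (simp add: nth_eq_iff_index_eq)
  next
    case False
    then show ?thesis
      using permutes_not_in[OF s] permutes_not_in[OF t] by simp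
  qed
  with \<open>js = js'\<close> show "s = t \<and> js = js'" by auto
qed

lemma schur_agler_permanental_compound:
  assumes "S \<in> schur_agler TYPE('h::ab_group_add) d {..<n} {..<n}"
  shows "(\<lambda>z. permanental_compound k (S z))
           \<in> schur_agler TYPE('h) d (increasing_seqs n k) (increasing_seqs n k)"
proof -
  let ?P = "{p. p permutes {..<k}}" and ?W = "{is. set is \<subseteq> {..<n} \<and> length is = k}"
  have W: "case_prod permute_list ` (?P \<times> increasing_seqs n k) \<subseteq> ?W"
    by (auto simp: increasing_seqs_def)
  have "finite ?W" "finite ?P" "?P \<noteq> {}"
    by (auto intro: finite_lists_length_eq finite_permutations permutes_id)
  then have "(\<lambda>z. average ?P permute_list permute_list (\<lambda>is js. \<Prod>a<k. S z (is ! a) (js ! a)))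
      \<in> schur_agler TYPE('h) d (increasing_seqs n k) (increasing_seqs n k)"
    using W inj_permute_list_increasing_seqs schur_agler_tensor_power[OF _ assms]
    by (intro schur_agler_average[of ?W ?W]) auto
  then show ?thesis
    by (rule schur_agler_cong)
       (auto simp: increasing_seqs_def average_permutations_eq_permanental_compound)
qed

theorem corollary4p4:
  fixes d n :: nat
    and S :: "(nat \<Rightarrow> complex) \<Rightarrow> nat \<Rightarrow> nat \<Rightarrow> complex"
  assumes "S \<in> schur_agler TYPE('h::ab_group_add) d {..<n} {..<n}"
  shows "(\<forall>k\<in>{1..n}. (\<lambda>z. permanental_compound k (S z))
            \<in> schur_agler TYPE('h) d (increasing_seqs n k) (increasing_seqs n k)) \<and>
         (\<lambda>z. permanent n (S z)) \<in> scalar_schur_agler TYPE('h) d"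
proof (intro conjI ballI)
  show "(\<lambda>z. permanental_compound k (S z))
      \<in> schur_agler TYPE('h) d (increasing_seqs n k) (increasing_seqs n k)" for k
    using assms by (rule schur_agler_permanental_compound)
next
  have fin: "finite (increasing_seqs n n)"
    by (rule finite_subset[OF _ finite_lists_length_eq[of "{..<n}" n]]) (auto simp: increasing_seqs_def)
  \<comment> \<open>The permanent is the entry of the \<open>n\<close>-th compound at this sequence
    and is extracted by reindexing with the unit type. For \<open>n = 0\<close> this uses the
    compound of order 0, which lies outside the range of \<open>k\<close> in the first
    conjunct.\<close>
  have "[0..<n] \<in> increasing_seqs n n"
    by (auto simp: increasing_seqs_def)
  then have "(\<lambda>z i j. permanental_compound n (S z) [0..<n] [0..<n]) \<in> schur_agler TYPE('h) d {()} {()}"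
    using schur_agler_reindex[OF fin fin _ _ _ _ schur_agler_permanental_compound[OF assms],
        of "\<lambda>_. [0..<n]" "{()}" "\<lambda>_. [0..<n]" "{()}"] by (simp add: inj_on_def)
  moreover have "permanental_compound n A [0..<n] [0..<n] = permanent n A" for A
  proof -
    have "p i < n" if "p permutes {..<n}" "i < n" for p i
      using permutes_in_image[OF that(1), of i] that(2) by simp
    then show ?thesis
      unfolding permanental_compound_def permanent_def by (intro sum.cong prod.cong) simp_all
  qed
  ultimately show "(\<lambda>z. permanent n (S z)) \<in> scalar_schur_agler TYPE('h) d"
    by (simp add: scalar_schur_agler_def)
qed

end
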